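(* Let $E$ be a vector lattice. Suppose that $E$ has an order dense ideal $F$ that admits a Hausdorff o-Lebesgue topology $\tau_F$. Then $E$ admits a (necessarily unique) Hausdorff uo-Lebesgue topology $\widehat\tau_E$. This topology $\widehat\tau_E$ is equal to $\mathrm{u}_S\tau_F$ for every subset $S$ of $F$ such that the ideal $I_S\subseteq F$ generated by $S$ is order dense in $E$. For every such $S$ and every net $(x_\alpha)_{\alpha\in\mathcal A}$ in $E$, the following are equivalent: (1) $x_\alpha\to 0$ in $\widehat\tau_E$; (2) $|x_\alpha|\wedge|s|\to 0$ in $(F,\tau_F)$ for all $s\in S$; (3) $|x_\alpha|\wedge|y|\to 0$ in $(F,\tau_F)$ for all $y\in F$.
   Context: All vector lattices are real and Archimedean. A net $(x_\alpha)_{\alpha\in\mathcal A}$ in a vector lattice $E$ is order convergent to $x$ ($x_\alpha\xrightarrow{\mathrm o}x$) if there is a net $(y_\beta)_{\beta\in\mathcal B}$ in $E$ (possibly with a different index set) with $y_\beta\downarrow 0$ such that for every $\beta_0\in\mathcal B$ there is $\alpha_0\in\mathcal A$ with $|x-x_\alpha|\le y_{\beta_0}$ for all $\alpha\ge\alpha_0$. It is unbounded order convergent to $x$ ($x_\alpha\xrightarrow{\mathrm{uo}}x$) if $|x_\alpha-x|\wedge y\xrightarrow{\mathrm o}0$ in $E$ for all $y\in E^+$. A locally solid linear topology is a (not necessarily Hausdorff) vector space topology with a base of neighbourhoods of $0$ consisting of solid sets. An o-Lebesgue (resp. uo-Lebesgue) topology on $E$ is a locally solid linear topology $\tau$ such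 that $x_\alpha\xrightarrow{\mathrm o}x$ (resp. $x_\alpha\xrightarrow{\mathrm{uo}}x$) implies $x_\alpha\to x$ in $\tau$ for all nets. A vector sublattice $F$ of $E$ is order dense if for every $x\in E$ with $x>0$ there is $y\in F$ with $0<y\le x$. For an ideal $F$ of $E$ with a locally solid linear topology $\tau_F$ and a subset $S$ of $F$, $\mathrm{u}_S\tau_F$ denotes the unique topology on $E$ making the additive group $E$ a topological group such that a net $x_\alpha\to 0$ in it if and only if $|x_\alpha|\wedge|s|\to 0$ in $(F,\tau_F)$ for all $s\in S$ (such a topology exists). *)

theory Defs
  imports "HOL-Analysis.Analysis" "HOL-Library.Lattice_Algebras" "HOL-Library.Lub_Glb"
begin

class archimedean_vector_lattice = ordered_real_vector + lattice_ab_group_add_abs +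
  assumes archimedean: "(\<And>n::nat. of_nat n *\<^sub>R x \<le> y) \<Longrightarrow> x \<le> 0"


text \<open>
  A net is a function on a directed set \<open>A\<close>, directed by the preorder \<open>r\<close>, where
  \<open>(a, b) \<in> r\<close> means that \<open>a\<close> precedes \<open>b\<close>. Limits along it are limits along
  its filter of tails.
\<close>

definition directed_set :: "'i set \<Rightarrow> ('i \<times> 'i) set \<Rightarrow> bool" where
  "directed_set A r \<longleftrightarrow>
     A \<noteq> {} \<and> preorder_on A r \<and> (\<forall>a\<in>A. \<forall>b\<in>A. \<exists>c\<in>A. (a, c) \<in> r \<and> (b, c) \<in> r)"

definition tails :: "'i set \<Rightarrow> ('i \<times> 'i) set \<Rightarrow> 'i filter" where
  "tails A r = (INF a\<in>A. principal {b\<in>A. (a, b) \<in> r})"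

lemma directed_setD:
  assumes "directed_set A r" "a \<in> A" "b \<in> A"
  shows "\<exists>c\<in>A. (a, c) \<in> r \<and> (b, c) \<in> r"
  using assms(1)[unfolded directed_set_def, THEN conjunct2, THEN conjunct2] assms(2,3)
  by simp

lemma eventually_tails:
  assumes "directed_set A r"
  shows "eventually P (tails A r) \<longleftrightarrow> (\<exists>a\<in>A. \<forall>b\<in>A. (a, b) \<in> r \<longrightarrow> P b)"
proof -
  have tr: "trans r" and ne: "A \<noteq> {}"
    using assms by (auto simp: directed_set_def preorder_on_def)
  have "\<exists>c\<in>A. principal {d\<in>A. (c, d) \<in> r} \<le>
          inf (principal {d\<in>A. (a, d) \<in> r}) (principal {d\<in>A. (b, d) \<in> r})"
    if "a \<in> A" "b \<in> A" for a b
  proof -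
    obtain c where "c \<in> A" "(a, c) \<in> r" "(b, c) \<in> r"
      using directed_setD[OF assms \<open>a \<in> A\<close> \<open>b \<in> A\<close>] by blast
    then show ?thesis
      using tr by (intro bexI[of _ c]) (auto dest: transD)
  qed
  then show ?thesis
    unfolding tails_def using ne
    by (subst eventually_INF_base) (auto simp: eventually_principal)
qed


text \<open>
  Everything below is relative to a vector sublattice \<open>V\<close> of the ambient vector lattice,
  regarded as a vector lattice in its own right; \<open>V = UNIV\<close> gives the ambient one.
  In particular, the regulating net and its infimum are taken in \<open>V\<close>.
  Indexing the regulating net by the type of the vector lattice itself is no restriction:
  see \<open>order_convergentI\<close>.
\<close>

definition decreasing_to ::
    "'a::ord set \<Rightarrow> 'i set \<Rightarrow> ('i \<times> 'i) set \<Rightarrow> ('i \<Rightarrow> 'a) \<Rightarrow> 'a \<Rightarrow> bool" where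
  "decreasing_to V B s y z \<longleftrightarrow>
     y ` B \<subseteq> V \<and> (\<forall>(b, c)\<in>s. y c \<le> y b) \<and> isGlb V (y ` B) z"

definition order_convergent ::
    "'a::archimedean_vector_lattice set \<Rightarrow> ('i \<Rightarrow> 'a) \<Rightarrow> 'a \<Rightarrow> 'i filter \<Rightarrow> bool" where
  "order_convergent V x l G \<longleftrightarrow>
     (\<exists>(B::'a set) s y. directed_set B s \<and> decreasing_to V B s y 0 \<and>
        (\<forall>b\<in>B. \<forall>\<^sub>F a in G. \<bar>l - x a\<bar> \<le> y b))"

definition uo_convergent ::
    "'a::archimedean_vector_lattice set \<Rightarrow> ('i \<Rightarrow> 'a) \<Rightarrow> 'a \<Rightarrow> 'i filter \<Rightarrow> bool" where
  "uo_convergent V x l G \<longleftrightarrow>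
     (\<forall>y\<in>V. 0 \<le> y \<longrightarrow> order_convergent V (\<lambda>a. inf \<bar>x a - l\<bar> y) 0 G)"

lemma order_convergentI:
  fixes B :: "'b set"
  assumes dir: "directed_set B s" and dec: "decreasing_to V B s y 0"
    and dom: "\<forall>b\<in>B. \<forall>\<^sub>F a in G. \<bar>l - x a\<bar> \<le> y b"
  shows "order_convergent V x l G"
proof -
  let ?s = "{(u, v). u \<in> y ` B \<and> v \<in> y ` B \<and> v \<le> u}"
  have "\<exists>w\<in>y ` B. w \<le> y b \<and> w \<le> y c" if "b \<in> B" "c \<in> B" for b c
    using directed_setD[OF dir that] dec by (fastforce simp: decreasing_to_def)
  then have "directed_set (y ` B) ?s"
    using dir unfolding directed_set_def preorder_on_def
    by (auto simp: refl_on_def trans_def)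
  moreover have "decreasing_to V (y ` B) ?s (\<lambda>u. u) 0"
    using dec by (auto simp: decreasing_to_def)
  ultimately show ?thesis
    unfolding order_convergent_def using dom by (intro exI[of _ "y ` B"]) blast
qed


definition solid :: "'a::archimedean_vector_lattice set \<Rightarrow> 'a set \<Rightarrow> bool" where
  "solid V S \<longleftrightarrow> S \<subseteq> V \<and> (\<forall>x\<in>V. \<forall>y\<in>S. \<bar>x\<bar> \<le> \<bar>y\<bar> \<longrightarrow> x \<in> S)"

definition order_ideal :: "'a::archimedean_vector_lattice set \<Rightarrow> bool" where
  "order_ideal I \<longleftrightarrow> subspace I \<and> solid UNIV I"

definition order_dense :: "'a::archimedean_vector_lattice set \<Rightarrow> bool" where
  "order_dense D \<longleftrightarrow> (\<forall>x>0. \<exists>y\<in>D. 0 < y \<and> y \<le> x)"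

definition linear_topology :: "'a::real_vector set \<Rightarrow> 'a topology \<Rightarrow> bool" where
  "linear_topology V \<tau> \<longleftrightarrow> topspace \<tau> = V \<and>
     continuous_map (prod_topology \<tau> \<tau>) \<tau> (\<lambda>(x, y). x + y) \<and>
     continuous_map (prod_topology euclideanreal \<tau>) \<tau> (\<lambda>(c, x). c *\<^sub>R x)"

definition locally_solid_topology ::
    "'a::archimedean_vector_lattice set \<Rightarrow> 'a topology \<Rightarrow> bool" where
  "locally_solid_topology V \<tau> \<longleftrightarrow>
     linear_topology V \<tau> \<and> neighbourhood_base_at 0 (solid V) \<tau>"


text \<open>
  Quantification over all nets in \<open>V\<close> is expressed by nets whose index set lies in
  \<^typ>\<open>'a set \<times> 'a\<close>. This type is large enough for the properties to carry over to nets with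
  arbitrary index types, as \<open>o_Lebesgue_any_net\<close>, \<open>uo_Lebesgue_any_net\<close> and
  \<open>is_unbounded_topology_any_net\<close> show.
\<close>

definition o_Lebesgue_topology ::
    "'a::archimedean_vector_lattice set \<Rightarrow> 'a topology \<Rightarrow> bool" where
  "o_Lebesgue_topology V \<tau> \<longleftrightarrow> locally_solid_topology V \<tau> \<and>
     (\<forall>(A::('a set \<times> 'a) set) r x. \<forall>l\<in>V. directed_set A r \<and> x ` A \<subseteq> V \<and>
        order_convergent V x l (tails A r) \<longrightarrow> limitin \<tau> x l (tails A r))"

definition uo_Lebesgue_topology ::
    "'a::archimedean_vector_lattice set \<Rightarrow> 'a topology \<Rightarrow> bool" where
  "uo_Lebesgue_topology V \<tau> \<longleftrightarrow> locally_solid_topology V \<tau> \<and>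
     (\<forall>(A::('a set \<times> 'a) set) r x. \<forall>l\<in>V. directed_set A r \<and> x ` A \<subseteq> V \<and>
        uo_convergent V x l (tails A r) \<longrightarrow> limitin \<tau> x l (tails A r))"

definition additive_group_topology :: "'a::ab_group_add topology \<Rightarrow> bool" where
  "additive_group_topology \<tau> \<longleftrightarrow> topspace \<tau> = UNIV \<and>
     continuous_map (prod_topology \<tau> \<tau>) \<tau> (\<lambda>(x, y). x + y) \<and>
     continuous_map \<tau> \<tau> uminus"

text \<open>
  \<open>is_unbounded_topology \<tau>F S \<tau>\<close> is the defining property of \<open>\<tau> = u\<^sub>S \<tau>F\<close>, for a topology
  \<open>\<tau>F\<close> on an ideal and a subset \<open>S\<close> of that ideal.
\<close>

definition is_unbounded_topology ::
    "'a::archimedean_vector_lattice topology \<Rightarrow> 'a set \<Rightarrow> 'a topology \<Rightarrow> bool" where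
  "is_unbounded_topology \<tau>F S \<tau> \<longleftrightarrow> additive_group_topology \<tau> \<and>
     (\<forall>(A::('a set \<times> 'a) set) r x. directed_set A r \<longrightarrow>
        (limitin \<tau> x 0 (tails A r) \<longleftrightarrow>
           (\<forall>s\<in>S. limitin \<tau>F (\<lambda>a. inf \<bar>x a\<bar> \<bar>s\<bar>) 0 (tails A r))))"


lemma canonical_net:
  fixes x :: "'i \<Rightarrow> 'a"
  assumes "directed_set A r"
  obtains A' :: "('a set \<times> 'a) set" and r'
  where "directed_set A' r'" "snd ` A' = x ` A"
    "\<And>P. eventually (\<lambda>p. P (snd p)) (tails A' r') \<longleftrightarrow> eventually (\<lambda>a. P (x a)) (tails A r)"
proof -
  define T where "T a = x ` {b\<in>A. (a, b) \<in> r}" for a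
  define A' where "A' = (SIGMA U:T ` A. U)"
  define r' where "r' = {(p, q). p \<in> A' \<and> q \<in> A' \<and> fst q \<subseteq> fst p}"
  have refl: "(a, a) \<in> r" if "a \<in> A" for a
    using assms that by (auto simp: directed_set_def preorder_on_def refl_on_def)
  have tr: "trans r"
    using assms by (auto simp: directed_set_def preorder_on_def)
  have self: "x a \<in> T a" if "a \<in> A" for a
    using refl that by (auto simp: T_def)
  have mono: "T b \<subseteq> T a" if "(a, b) \<in> r" for a b
    using tr that by (auto simp: T_def dest: transD)
  have "\<exists>q\<in>A'. (p1, q) \<in> r' \<and> (p2, q) \<in> r'" if "p1 \<in> A'" "p2 \<in> A'" for p1 p2
  proof -
    have "fst p1 \<in> T ` A" "fst p2 \<in> T ` A"
      using that by (auto simp: A'_def)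
    then obtain a b where ab: "a \<in> A" "b \<in> A" "fst p1 = T a" "fst p2 = T b"
      by blast
    obtain c where c: "c \<in> A" "(a, c) \<in> r" "(b, c) \<in> r"
      using directed_setD[OF assms ab(1,2)] by blast
    have "(T c, x c) \<in> A'"
      using c self by (auto simp: A'_def)
    then show ?thesis
      using that ab c mono by (intro bexI[of _ "(T c, x c)"]) (auto simp: r'_def)
  qed
  moreover have "preorder_on A' r'"
    by (auto simp: preorder_on_def refl_on_def trans_def r'_def)
  moreover have "A' \<noteq> {}"
  proof -
    obtain a where "a \<in> A" using assms by (auto simp: directed_set_def)
    then have "(T a, x a) \<in> A'" using self by (auto simp: A'_def)
    then show ?thesis by blast
  qed
  ultimately have dir: "directed_set A' r'"
    by (simp add: directed_set_def)
  have img: "snd ` A' = x ` A"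
  proof
    show "snd ` A' \<subseteq> x ` A" by (auto simp: A'_def T_def)
    show "x ` A \<subseteq> snd ` A'"
    proof
      fix v assume "v \<in> x ` A"
      then obtain a where "a \<in> A" "v = x a" by blast
      then have "(T a, v) \<in> A'" using self by (auto simp: A'_def)
      then show "v \<in> snd ` A'" by force
    qed
  qed
  have ev: "eventually (\<lambda>p. P (snd p)) (tails A' r') \<longleftrightarrow> eventually (\<lambda>a. P (x a)) (tails A r)" for P
    unfolding eventually_tails[OF dir] eventually_tails[OF assms]
  proof
    assume "\<exists>p\<in>A'. \<forall>q\<in>A'. (p, q) \<in> r' \<longrightarrow> P (snd q)"
    then obtain p where p: "p \<in> A'" "\<And>q. q \<in> A' \<Longrightarrow> (p, q) \<in> r' \<Longrightarrow> P (snd q)" by blast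
    then obtain a where a: "a \<in> A" "fst p = T a" by (auto simp: A'_def)
    have "P (x b)" if "b \<in> A" "(a, b) \<in> r" for b
    proof -
      have "(T a, x b) \<in> A'" using that a by (auto simp: A'_def T_def)
      then show ?thesis using p a by (force simp: r'_def)
    qed
    then show "\<exists>a\<in>A. \<forall>b\<in>A. (a, b) \<in> r \<longrightarrow> P (x b)" using a by blast
  next
    assume "\<exists>a\<in>A. \<forall>b\<in>A. (a, b) \<in> r \<longrightarrow> P (x b)"
    then obtain a where a: "a \<in> A" "\<And>b. b \<in> A \<Longrightarrow> (a, b) \<in> r \<Longrightarrow> P (x b)" by blast
    have "P (snd q)" if "q \<in> A'" "((T a, x a), q) \<in> r'" for q
    proof -
      have "snd q \<in> T a" using that by (auto simp: r'_def A'_def)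
      then show ?thesis using a by (auto simp: T_def)
    qed
    moreover have "(T a, x a) \<in> A'" using a self by (auto simp: A'_def)
    ultimately show "\<exists>p\<in>A'. \<forall>q\<in>A'. (p, q) \<in> r' \<longrightarrow> P (snd q)" by blast
  qed
  show ?thesis using that dir img ev by blast
qed

lemma o_Lebesgue_any_net:
  fixes A :: "'i set"
  assumes "o_Lebesgue_topology V \<tau>" "directed_set A r" "x ` A \<subseteq> V" "l \<in> V"
    "order_convergent V x l (tails A r)"
  shows "limitin \<tau> x l (tails A r)"
proof -
  obtain A' :: "('a set \<times> 'a) set" and r' where N: "directed_set A' r'" "snd ` A' = x ` A"
    and ev: "\<And>P. eventually (\<lambda>p. P (snd p)) (tails A' r') \<longleftrightarrow> eventually (\<lambda>a. P (x a)) (tails A r)"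
    by (rule canonical_net[OF assms(2), of x]) blast
  have "order_convergent V snd l (tails A' r')"
    using assms(5) by (simp add: order_convergent_def ev[of "\<lambda>v. abs (l - v) \<le> _"])
  then have "limitin \<tau> snd l (tails A' r')"
    using assms N unfolding o_Lebesgue_topology_def by blast
  then show ?thesis
    by (simp add: limitin_def ev[of "\<lambda>v. v \<in> _"])
qed

lemma uo_Lebesgue_any_net:
  fixes A :: "'i set"
  assumes "uo_Lebesgue_topology V \<tau>" "directed_set A r" "x ` A \<subseteq> V" "l \<in> V"
    "uo_convergent V x l (tails A r)"
  shows "limitin \<tau> x l (tails A r)"
proof -
  obtain A' :: "('a set \<times> 'a) set" and r' where N: "directed_set A' r'" "snd ` A' = x ` A"
    and ev: "\<And>P. eventually (\<lambda>p. P (snd p)) (tails A' r') \<longleftrightarrow> eventually (\<lambda>a. P (x a)) (tails A r)"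
    by (rule canonical_net[OF assms(2), of x]) blast
  have "uo_convergent V snd l (tails A' r')"
    using assms(5) by (simp add: uo_convergent_def order_convergent_def
        ev[of "\<lambda>v. inf (abs (v - l)) _ \<le> _"])
  then have "limitin \<tau> snd l (tails A' r')"
    using assms N unfolding uo_Lebesgue_topology_def by blast
  then show ?thesis
    by (simp add: limitin_def ev[of "\<lambda>v. v \<in> _"])
qed

lemma is_unbounded_topology_any_net:
  fixes A :: "'i set"
  assumes "is_unbounded_topology \<tau>F S \<tau>" "directed_set A r"
  shows "limitin \<tau> x 0 (tails A r) \<longleftrightarrow>
           (\<forall>s\<in>S. limitin \<tau>F (\<lambda>a. inf \<bar>x a\<bar> \<bar>s\<bar>) 0 (tails A r))"
proof -
  obtain A' :: "('a set \<times> 'a) set" and r' where N: "directed_set A' r'" "snd ` A' = x ` A"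
    and ev: "\<And>P. eventually (\<lambda>p. P (snd p)) (tails A' r') \<longleftrightarrow> eventually (\<lambda>a. P (x a)) (tails A r)"
    by (rule canonical_net[OF assms(2), of x]) blast
  have "limitin \<tau> snd 0 (tails A' r') \<longleftrightarrow>
           (\<forall>s\<in>S. limitin \<tau>F (\<lambda>a. inf \<bar>snd a\<bar> \<bar>s\<bar>) 0 (tails A' r'))"
    using assms N unfolding is_unbounded_topology_def by blast
  then show ?thesis
    by (simp add: limitin_def ev[of "\<lambda>v. v \<in> _"] ev[of "\<lambda>v. inf (abs v) _ \<in> _"])
qed

end

(*
  The sets {x. |x| inf |y| in W}, for y in F and W a solid zero neighbourhood of F, are a base
  at zero of a locally solid topology on E. They are absorbing because |x|/n inf |y| decreases
  to zero, and the topology is uo-Lebesgue and Hausdorff because F is an order dense ideal.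
  For a fixed net x, the y in F such that |x_a| inf |y| converges to zero form an ideal J of F.
  If J contains S, it is order dense, hence every positive y in F is the supremum of the
  elements of J below it, and the o-Lebesgue property gives J = F.

  Uniqueness: let sigma and tau be uo-Lebesgue with sigma Hausdorff, and let U be a zero
  neighbourhood of tau. A sequence V_n of solid zero neighbourhoods of sigma with
  V_(n+1) + V_(n+1) <= V_n has as intersection an order closed ideal N. Since sigma is Hausdorff,
  the disjoint complements of these N are jointly order dense, so any net that selects a point
  from each N is uo-null; hence some N is small in tau. If no V_n lay in U, choose x_n in V_n - U.
  Up to a tau-small error, |x_n| is dominated by p_n + q_n with p_n in N and q_n in V_n disjoint
  from N. Then q_n is uo-null, so x_n in U for some n, a contradiction.
*)

theory Submission
  imports Defs
begin

section \<open>Ideals and Archimedean arguments\<close>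

text \<open>Families decreasing to zero replace them: the gaps between the upper bounds and the
  members of a bounded directed set, and the gaps between \<open>y\<close> and the elements below it
  of an order dense ideal. The Archimedean axiom makes their infimum zero, and an o-Lebesgue
  topology then makes some gap small. The ideal \<open>N\<close> arises because \<sigma> need not be
  metrizable: countably many zero neighbourhoods need not separate points, and what they fail to see
  is controlled by a net. Splitting along \<open>N\<close> and its disjoint complement works only up
  to a \<tau>-small error, since an element need not have a component in \<open>N\<close>. That q_n
  is uo-null is a Borel-Cantelli argument: after truncation at some \<open>y\<close> disjoint from
  \<open>N\<close>, the tail sums capped at \<open>y\<close> have an upper bound in V_n, and
  whatever is positive and below all such bounds lies both in \<open>N\<close> and in its
  complement.\<close>

lemma inf_add_le:
  fixes a b y :: "'a::archimedean_vector_lattice"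
  assumes "0 \<le> a" "0 \<le> b" "0 \<le> y"
  shows "inf (a + b) y \<le> inf a y + inf b y"
proof -
  \<comment> \<open>Distributing addition over infima turns the right-hand side into the infimum of
    \<open>a + b\<close>, \<open>a + y\<close>, \<open>y + b\<close> and
    \<open>y + y\<close>.\<close>
  have "inf (a + b) y \<le> a + y" "inf (a + b) y \<le> y + b" "inf (a + b) y \<le> y + y"
    using assms by (auto intro: le_infI2 add_increasing add_increasing2)
  then show ?thesis
    by (simp add: add_sup_inf_distribs)
qed

lemma abs_scaleR_le:
  fixes x :: "'a::archimedean_vector_lattice"
  shows "\<bar>c *\<^sub>R x\<bar> \<le> \<bar>c\<bar> *\<^sub>R \<bar>x\<bar>"
proof -
  have *: "c *\<^sub>R x \<le> \<bar>c\<bar> *\<^sub>R \<bar>x\<bar>" for c and x :: 'a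
  proof (cases "0 \<le> c")
    case True
    then show ?thesis by (simp add: scaleR_left_mono abs_ge_self)
  next
    case False
    then have "(- c) *\<^sub>R (- x) \<le> (- c) *\<^sub>R \<bar>x\<bar>"
      by (intro scaleR_left_mono) (auto intro: abs_ge_minus_self)
    then show ?thesis using False by simp
  qed
  show ?thesis
    using *[of c x] *[of c "- x"] by (auto intro: abs_leI)
qed

lemma abs_scaleR_mono:
  fixes x :: "'a::archimedean_vector_lattice"
  assumes "\<bar>c\<bar> \<le> \<bar>k\<bar>"
  shows "\<bar>c *\<^sub>R x\<bar> \<le> \<bar>k *\<^sub>R x\<bar>"
proof (cases "k = 0")
  case False
  have "\<bar>c *\<^sub>R x\<bar> \<le> \<bar>k\<bar> *\<^sub>R \<bar>x\<bar>"
    using abs_scaleR_le[of c x] assms by (meson abs_ge_zero order_trans scaleR_right_mono)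
  \<comment> \<open>Rescaling by \<open>1 / k\<close> turns the one-sided estimate
    \<open>abs_scaleR_le\<close> into the reverse one.\<close>
  also have "\<dots> = \<bar>k\<bar> *\<^sub>R \<bar>(1 / k) *\<^sub>R (k *\<^sub>R x)\<bar>"
    using False by simp
  also have "\<dots> \<le> \<bar>k\<bar> *\<^sub>R (\<bar>1 / k\<bar> *\<^sub>R \<bar>k *\<^sub>R x\<bar>)"
    using abs_scaleR_le[of "1 / k" "k *\<^sub>R x"] by (intro scaleR_left_mono) auto
  also have "\<dots> = \<bar>k *\<^sub>R x\<bar>"
    using False by simp
  finally show ?thesis .
qed (use assms in auto)

text \<open>Sums give natural multiples; solidity then gives every real multiple by comparison with
  a natural number above |c|.\<close>

lemma order_idealI:
  fixes I :: "'a::archimedean_vector_lattice set"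
  assumes "0 \<in> I" and add: "\<And>x y. x \<in> I \<Longrightarrow> y \<in> I \<Longrightarrow> x + y \<in> I"
    and sol: "\<And>x y. y \<in> I \<Longrightarrow> \<bar>x\<bar> \<le> \<bar>y\<bar> \<Longrightarrow> x \<in> I"
  shows "order_ideal I"
proof -
  have nat: "of_nat k *\<^sub>R x \<in> I" if "x \<in> I" for k x
    using that assms(1) add by (induction k) (auto simp: scaleR_add_left)
  have "c *\<^sub>R x \<in> I" if "x \<in> I" for c x
  proof -
    obtain k :: nat where "\<bar>c\<bar> \<le> \<bar>of_nat k\<bar>"
      using real_arch_simple[of "\<bar>c\<bar>"] by auto
    then show ?thesis
      using sol[OF nat[OF that]] abs_scaleR_mono by blast
  qed
  then show ?thesis
    using assms by (auto simp: order_ideal_def solid_def subspace_def)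
qed

lemma order_ideal_UNIV: "order_ideal UNIV"
  by (auto intro: order_idealI)

lemma order_ideal_0: "order_ideal I \<Longrightarrow> 0 \<in> I"
  by (simp add: order_ideal_def subspace_0)

lemma order_ideal_add: "order_ideal I \<Longrightarrow> x \<in> I \<Longrightarrow> y \<in> I \<Longrightarrow> x + y \<in> I"
  by (simp add: order_ideal_def subspace_add)

lemma order_ideal_solid: "order_ideal I \<Longrightarrow> y \<in> I \<Longrightarrow> \<bar>x\<bar> \<le> \<bar>y\<bar> \<Longrightarrow> x \<in> I"
  by (auto simp: order_ideal_def solid_def)

lemma order_ideal_le: "order_ideal I \<Longrightarrow> y \<in> I \<Longrightarrow> 0 \<le> x \<Longrightarrow> x \<le> \<bar>y\<bar> \<Longrightarrow> x \<in> I"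
  by (auto intro: order_ideal_solid)

lemma order_ideal_abs: "order_ideal I \<Longrightarrow> y \<in> I \<Longrightarrow> \<bar>y\<bar> \<in> I"
  by (auto intro: order_ideal_solid)

text \<open>The form in which the Archimedean axiom computes infima: a lower bound \<open>z\<close>
  can be added to an admissible \<open>w\<close> again and again, so all multiples of
  \<open>z\<close> stay below \<open>y\<close>.\<close>

lemma le_zero_if_stable:
  fixes z :: "'a::archimedean_vector_lattice"
  assumes "P 0" and step: "\<And>w. P w \<Longrightarrow> P (w + z)" and bound: "\<And>w. P w \<Longrightarrow> w \<le> y"
  shows "z \<le> 0"
proof (rule archimedean[of z y])
  fix n :: nat
  have "P (of_nat n *\<^sub>R z)"
    using assms(1) step by (induction n) (auto simp: scaleR_add_left add.commute[of z])
  then show "of_nat n *\<^sub>R z \<le> y" by (rule bound)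
qed

definition disjoint_complement :: "'a::archimedean_vector_lattice set \<Rightarrow> 'a set" where
  "disjoint_complement N = {q. \<forall>p\<in>N. inf \<bar>p\<bar> \<bar>q\<bar> = 0}"

lemma order_ideal_disjoint_complement: "order_ideal (disjoint_complement N)"
proof (rule order_idealI)
  show "0 \<in> disjoint_complement N"
    by (simp add: disjoint_complement_def inf.absorb2)
next
  fix x y assume xy: "x \<in> disjoint_complement N" "y \<in> disjoint_complement N"
  show "x + y \<in> disjoint_complement N"
    unfolding disjoint_complement_def
  proof safe
    fix p assume p: "p \<in> N"
    have "inf \<bar>p\<bar> \<bar>x + y\<bar> \<le> inf (\<bar>x\<bar> + \<bar>y\<bar>) \<bar>p\<bar>"
      by (simp add: abs_triangle_ineq le_infI2)
    also have "\<dots> \<le> inf \<bar>x\<bar> \<bar>p\<bar> + inf \<bar>y\<bar> \<bar>p\<bar>"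
      by (rule inf_add_le) auto
    also have "\<dots> = 0"
      using xy p by (simp add: disjoint_complement_def inf.commute)
    finally show "inf \<bar>p\<bar> \<bar>x + y\<bar> = 0" by (simp add: antisym)
  qed
next
  fix x y assume xy: "y \<in> disjoint_complement N" "\<bar>x\<bar> \<le> \<bar>y\<bar>"
  show "x \<in> disjoint_complement N"
    unfolding disjoint_complement_def
  proof safe
    fix p assume p: "p \<in> N"
    have "inf \<bar>p\<bar> \<bar>x\<bar> \<le> inf \<bar>p\<bar> \<bar>y\<bar>"
      using xy by (simp add: le_infI2)
    also have "\<dots> = 0"
      using xy p by (simp add: disjoint_complement_def)
    finally show "inf \<bar>p\<bar> \<bar>x\<bar> = 0" by (simp add: antisym)
  qed
qed

text \<open>If disjointness fails at \<open>p\<close>, then \<open>inf |p| z\<close> is already the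
  required element of \<open>N\<close>. Hence \<open>N\<close> and its disjoint complement are
  jointly order dense.\<close>

lemma exists_below_in_or_disjoint:
  fixes z :: "'a::archimedean_vector_lattice"
  assumes N: "order_ideal N" and z: "0 < z"
  shows "(\<exists>y\<in>N. 0 < y \<and> y \<le> z) \<or> z \<in> disjoint_complement N"
proof (rule disjCI)
  assume "z \<notin> disjoint_complement N"
  then obtain p where p: "p \<in> N" "inf \<bar>p\<bar> \<bar>z\<bar> \<noteq> 0"
    by (auto simp: disjoint_complement_def)
  have "inf \<bar>p\<bar> z \<in> N"
    using p z by (intro order_ideal_le[OF N p(1)]) auto
  then show "\<exists>y\<in>N. 0 < y \<and> y \<le> z"
    using p z by (intro bexI[of _ "inf \<bar>p\<bar> z"]) (auto simp: less_le)
qed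

section \<open>Families decreasing to zero\<close>

text \<open>An index-free form of a net decreasing to zero: the set serves as its own index set
  under the reversed order. The infimum is computed inside \<open>V\<close>.\<close>

definition directed_to_zero :: "'a::archimedean_vector_lattice set \<Rightarrow> 'a set \<Rightarrow> bool" where
  "directed_to_zero V D \<longleftrightarrow> D \<subseteq> V \<and> D \<noteq> {} \<and> (\<forall>a\<in>D. \<forall>b\<in>D. \<exists>c\<in>D. c \<le> a \<and> c \<le> b) \<and>
     (\<forall>d\<in>D. 0 \<le> d) \<and> (\<forall>z\<in>V. (\<forall>d\<in>D. z \<le> d) \<longrightarrow> z \<le> 0)"

text \<open>In other words, \<open>y\<close> is the supremum of the elements of \<open>J\<close>
  below it. A positive lower bound of the gaps would dominate some \<open>u > 0\<close> in
  \<open>J\<close>, and adding \<open>u\<close> to any admissible \<open>w\<close> would stay below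
  \<open>y\<close>. Density is asked only below \<open>y\<close>, because
  \<open>normal_Inter_order_closed\<close> can offer it only there.\<close>

lemma directed_to_zero_differences:
  fixes y :: "'a::archimedean_vector_lattice"
  assumes V: "order_ideal V" "y \<in> V" and J: "order_ideal J" and "0 \<le> y"
    and dense: "\<And>z. 0 < z \<Longrightarrow> z \<le> y \<Longrightarrow> \<exists>u\<in>J. 0 < u \<and> u \<le> z"
  shows "directed_to_zero V {y - w | w. w \<in> J \<and> 0 \<le> w \<and> w \<le> y}"
  unfolding directed_to_zero_def
proof (intro conjI)
  show "{y - w |w. w \<in> J \<and> 0 \<le> w \<and> w \<le> y} \<subseteq> V"
    using \<open>0 \<le> y\<close> by (auto intro!: order_ideal_le[OF V(1,2)])
  show "{y - w |w. w \<in> J \<and> 0 \<le> w \<and> w \<le> y} \<noteq> {}"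
    using order_ideal_0[OF J] \<open>0 \<le> y\<close> by auto
  have "sup w v \<in> J" if "w \<in> J" "0 \<le> w" "v \<in> J" "0 \<le> v" for w v
  proof (rule order_ideal_le[OF J order_ideal_add[OF J that(1,3)]])
    show "0 \<le> sup w v" using that by (simp add: le_supI1)
    show "sup w v \<le> \<bar>w + v\<bar>"
      using that by (simp add: add_increasing add_increasing2)
  qed
  then show "\<forall>a\<in>{y - w |w. w \<in> J \<and> 0 \<le> w \<and> w \<le> y}. \<forall>b\<in>{y - w |w. w \<in> J \<and> 0 \<le> w \<and> w \<le> y}.
      \<exists>c\<in>{y - w |w. w \<in> J \<and> 0 \<le> w \<and> w \<le> y}. c \<le> a \<and> c \<le> b"
  proof safe
    fix w v assume wv: "w \<in> J" "0 \<le> w" "w \<le> y" "v \<in> J" "0 \<le> v" "v \<le> y"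
    have "sup w v \<in> J \<and> 0 \<le> sup w v \<and> sup w v \<le> y"
      using wv \<open>\<And>w v. w \<in> J \<Longrightarrow> 0 \<le> w \<Longrightarrow> v \<in> J \<Longrightarrow> 0 \<le> v \<Longrightarrow> sup w v \<in> J\<close>
      by (auto intro: le_supI1)
    then show "\<exists>c\<in>{y - w |w. w \<in> J \<and> 0 \<le> w \<and> w \<le> y}. c \<le> y - w \<and> c \<le> y - v"
      by (intro bexI[of _ "y - sup w v"] conjI diff_left_mono CollectI exI[of _ "sup w v"]) auto
  qed
  show "\<forall>d\<in>{y - w |w. w \<in> J \<and> 0 \<le> w \<and> w \<le> y}. 0 \<le> d"
    by auto
  show "\<forall>z\<in>V. (\<forall>d\<in>{y - w |w. w \<in> J \<and> 0 \<le> w \<and> w \<le> y}. z \<le> d) \<longrightarrow> z \<le> 0"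
  proof (intro ballI impI)
    fix z assume z: "\<forall>d\<in>{y - w |w. w \<in> J \<and> 0 \<le> w \<and> w \<le> y}. z \<le> d"
    \<comment> \<open>Zero is a lower bound as well, so \<open>z\<close> may be replaced by its
      positive part, to which density applies.\<close>
    have zw: "sup z 0 \<le> y - w" if "w \<in> J" "0 \<le> w" "w \<le> y" for w
      using z that by auto
    have "sup z 0 \<le> y"
      using zw[of 0] order_ideal_0[OF J] \<open>0 \<le> y\<close> by simp
    show "z \<le> 0"
    proof (rule ccontr)
      assume "\<not> z \<le> 0"
      then have "0 < sup z 0"
        by (metis less_le sup_ge1 sup_ge2)
      then obtain u where u: "u \<in> J" "0 < u" "u \<le> sup z 0"
        using dense \<open>sup z 0 \<le> y\<close> by blast
      have "u \<le> 0"
      proof (rule le_zero_if_stable[where P = "\<lambda>w. w \<in> J \<and> 0 \<le> w \<and> w \<le> y" and y = y])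
        show "0 \<in> J \<and> (0::'a) \<le> 0 \<and> 0 \<le> y"
          using order_ideal_0[OF J] \<open>0 \<le> y\<close> by simp
        show "w + u \<in> J \<and> 0 \<le> w + u \<and> w + u \<le> y" if "w \<in> J \<and> 0 \<le> w \<and> w \<le> y" for w
        proof -
          have "u \<le> y - w" using u(3) zw that order_trans by blast
          then show ?thesis
            using that u order_ideal_add[OF J] by (auto simp: le_diff_eq add.commute)
        qed
      qed auto
      then show False using u(2) by simp
    qed
  qed
qed

text \<open>A substitute for the supremum of \<open>S\<close>. If \<open>z\<close> lies below all
  gaps, then subtracting \<open>z\<close> from an upper bound leaves an upper bound; starting at
  \<open>y\<close>, every \<open>y - n z\<close> is one, which bounds all multiples of
  \<open>z\<close> by \<open>y - s0\<close>.\<close>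

lemma directed_to_zero_upper_bounds:
  fixes S :: "'a::archimedean_vector_lattice set"
  assumes "S \<noteq> {}" and dir: "\<And>a b. a \<in> S \<Longrightarrow> b \<in> S \<Longrightarrow> \<exists>c\<in>S. a \<le> c \<and> b \<le> c"
    and bdd: "\<And>a. a \<in> S \<Longrightarrow> a \<le> y"
  shows "directed_to_zero UNIV {u - s | u s. s \<in> S \<and> (\<forall>t\<in>S. t \<le> u)}" (is "directed_to_zero UNIV ?D")
  unfolding directed_to_zero_def
proof (intro conjI)
  show "?D \<noteq> {}" using assms(1) bdd by blast
  show "\<forall>d\<in>?D. 0 \<le> d" by auto
  show "\<forall>a\<in>?D. \<forall>b\<in>?D. \<exists>c\<in>?D. c \<le> a \<and> c \<le> b"
  proof safe
    fix u s v t
    assume s: "s \<in> S" "\<forall>r\<in>S. r \<le> u" and t: "t \<in> S" "\<forall>r\<in>S. r \<le> v"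
    obtain r where r: "r \<in> S" "s \<le> r" "t \<le> r" using dir s t by blast
    then have "inf u v - r \<le> u - s" "inf u v - r \<le> v - t" by (auto intro: diff_mono)
    then show "\<exists>c\<in>?D. c \<le> u - s \<and> c \<le> v - t"
      using r s t by (intro bexI[of _ "inf u v - r"] CollectI exI[of _ "inf u v"] exI[of _ r]) auto
  qed
  obtain s0 where s0: "s0 \<in> S" using assms(1) by blast
  show "\<forall>z\<in>UNIV. (\<forall>d\<in>?D. z \<le> d) \<longrightarrow> z \<le> 0"
  proof (intro ballI impI)
    fix z assume z: "\<forall>d\<in>?D. z \<le> d"
    show "z \<le> 0"
    proof (rule le_zero_if_stable[where P = "\<lambda>w. \<forall>t\<in>S. t \<le> y - w" and y = "y - s0"])
      show "\<forall>t\<in>S. t \<le> y - 0" using bdd by simp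
      show "\<forall>t\<in>S. t \<le> y - (w + z)" if w: "\<forall>t\<in>S. t \<le> y - w" for w
      proof
        fix t assume "t \<in> S"
        then have "z \<le> (y - w) - t" using z w by blast
        then show "t \<le> y - (w + z)" by (simp add: algebra_simps)
      qed
      show "w \<le> y - s0" if "\<forall>t\<in>S. t \<le> y - w" for w
        using that s0 by (auto simp: algebra_simps)
    qed
  qed
qed simp

section \<open>Order convergence\<close>

lemma tails_neq_bot: "directed_set A r \<Longrightarrow> tails A r \<noteq> bot"
  unfolding trivial_limit_def
  by (subst eventually_tails) (auto simp: directed_set_def preorder_on_def refl_on_def)

text \<open>Every regulating net can be replaced by the largest one, the set of all eventual upper
  bounds in \<open>V\<close> ordered downwards. Since \<open>G\<close> is nontrivial and
  \<open>x\<close> is nonnegative, these bounds are nonnegative, so only the lower bounds above zero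
  have to be excluded.\<close>

lemma order_convergent_0_iff:
  fixes V :: "'a::archimedean_vector_lattice set"
  assumes V: "order_ideal V" and G: "G \<noteq> bot" and nonneg: "\<And>a. 0 \<le> x a"
  shows "order_convergent V x 0 G \<longleftrightarrow> (\<exists>d\<in>V. \<forall>\<^sub>F a in G. x a \<le> d) \<and>
           (\<forall>z\<in>V. (\<forall>d\<in>V. (\<forall>\<^sub>F a in G. x a \<le> d) \<longrightarrow> z \<le> d) \<longrightarrow> z \<le> 0)"
proof
  assume "order_convergent V x 0 G"
  then obtain B :: "'a set" and s y where B: "directed_set B s" "decreasing_to V B s y 0"
    and ev: "\<And>b. b \<in> B \<Longrightarrow> \<forall>\<^sub>F a in G. \<bar>0 - x a\<bar> \<le> y b"
    unfolding order_convergent_def by blast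
  have yV: "y ` B \<subseteq> V" and glb: "isGlb V (y ` B) 0"
    using B(2) by (auto simp: decreasing_to_def)
  have ev': "\<forall>\<^sub>F a in G. x a \<le> y b" if "b \<in> B" for b
    using ev[OF that] nonneg by simp
  show "(\<exists>d\<in>V. \<forall>\<^sub>F a in G. x a \<le> d) \<and>
           (\<forall>z\<in>V. (\<forall>d\<in>V. (\<forall>\<^sub>F a in G. x a \<le> d) \<longrightarrow> z \<le> d) \<longrightarrow> z \<le> 0)"
  proof (intro conjI ballI impI)
    show "\<exists>d\<in>V. \<forall>\<^sub>F a in G. x a \<le> d"
      using B(1) ev' yV unfolding directed_set_def by blast
    fix z assume "z \<in> V" "\<forall>d\<in>V. (\<forall>\<^sub>F a in G. x a \<le> d) \<longrightarrow> z \<le> d"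
    then have "isLb V (y ` B) z"
      using ev' yV by (auto intro!: isLbI setgeI)
    then show "z \<le> 0" using glb isGlb_le_isLb by blast
  qed
next
  assume *: "(\<exists>d\<in>V. \<forall>\<^sub>F a in G. x a \<le> d) \<and>
           (\<forall>z\<in>V. (\<forall>d\<in>V. (\<forall>\<^sub>F a in G. x a \<le> d) \<longrightarrow> z \<le> d) \<longrightarrow> z \<le> 0)"
  define D where "D = {d\<in>V. \<forall>\<^sub>F a in G. x a \<le> d}"
  define r where "r = {(a, b). a \<in> D \<and> b \<in> D \<and> b \<le> a}"
  have pos: "0 \<le> d" if d: "d \<in> D" for d
  proof -
    obtain a where "x a \<le> d"
      using d eventually_happens'[OF G, of "\<lambda>a. x a \<le> d"] by (auto simp: D_def)
    then show ?thesis using nonneg order_trans by blast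
  qed
  have inf_D: "inf a b \<in> D" if "a \<in> D" "b \<in> D" for a b
  proof -
    have "inf a b \<in> V"
    proof (rule order_ideal_le[OF V])
      show "a \<in> V" using that by (simp add: D_def)
      show "0 \<le> inf a b" using pos that by simp
      show "inf a b \<le> \<bar>a\<bar>" by (simp add: abs_ge_self le_infI1)
    qed
    then show ?thesis
      using that by (auto simp: D_def intro: eventually_conj)
  qed
  have "directed_set D r"
    unfolding directed_set_def preorder_on_def
  proof (intro conjI ballI)
    show "D \<noteq> {}" using * by (auto simp: D_def)
    show "r \<subseteq> D \<times> D" by (auto simp: r_def)
    show "refl_on D r" by (auto simp: r_def refl_on_def)
    show "trans r" by (auto simp: r_def trans_def)
    fix a b assume "a \<in> D" "b \<in> D"
    then show "\<exists>c\<in>D. (a, c) \<in> r \<and> (b, c) \<in> r"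
      using inf_D by (intro bexI[of _ "inf a b"]) (auto simp: r_def)
  qed
  moreover have "decreasing_to V D r (\<lambda>d. d) 0"
    unfolding decreasing_to_def
  proof (intro conjI)
    show "isGlb V ((\<lambda>d. d) ` D) 0"
      using pos * order_ideal_0[OF V]
      by (intro isGlbI2 isLbI setgeI setleI) (auto simp: isLb_def setge_def D_def)
  qed (auto simp: r_def D_def)
  ultimately show "order_convergent V x 0 G"
    by (rule order_convergentI) (auto simp: D_def nonneg)
qed

text \<open>Meeting an eventual upper bound with |y| brings it into \<open>F\<close> and keeps it an
  eventual upper bound, so bounds taken in \<open>F\<close> have no larger infimum than those taken
  in the whole lattice.\<close>

lemma order_convergent_subideal:
  fixes F :: "'a::archimedean_vector_lattice set"
  assumes F: "order_ideal F" "y \<in> F" and G: "G \<noteq> bot"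
    and conv: "order_convergent UNIV (\<lambda>a. inf \<bar>x a\<bar> \<bar>y\<bar>) 0 G"
  shows "order_convergent F (\<lambda>a. inf \<bar>x a\<bar> \<bar>y\<bar>) 0 G"
proof -
  have nonneg: "0 \<le> inf \<bar>x a\<bar> \<bar>y\<bar>" for a by simp
  have *: "z \<le> 0" if "\<And>d. (\<forall>\<^sub>F a in G. inf \<bar>x a\<bar> \<bar>y\<bar> \<le> d) \<Longrightarrow> z \<le> d" for z
    using conv that unfolding order_convergent_0_iff[OF order_ideal_UNIV G nonneg] by blast
  show ?thesis
    unfolding order_convergent_0_iff[OF F(1) G nonneg]
  proof (intro conjI ballI impI)
    show "\<exists>d\<in>F. \<forall>\<^sub>F a in G. inf \<bar>x a\<bar> \<bar>y\<bar> \<le> d"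
      using order_ideal_abs[OF F] by (intro bexI[of _ "\<bar>y\<bar>"]) auto
    fix z assume z: "\<forall>d\<in>F. (\<forall>\<^sub>F a in G. inf \<bar>x a\<bar> \<bar>y\<bar> \<le> d) \<longrightarrow> z \<le> d"
    show "z \<le> 0"
    proof (rule *)
      fix d assume d: "\<forall>\<^sub>F a in G. inf \<bar>x a\<bar> \<bar>y\<bar> \<le> d"
      then obtain a where "inf \<bar>x a\<bar> \<bar>y\<bar> \<le> d"
        using eventually_happens'[OF G] by blast
      moreover have "0 \<le> inf \<bar>x a\<bar> \<bar>y\<bar>" by simp
      ultimately have "0 \<le> d" by order
      then have "inf d \<bar>y\<bar> \<in> F"
        by (intro order_ideal_le[OF F]) auto
      moreover have "\<forall>\<^sub>F a in G. inf \<bar>x a\<bar> \<bar>y\<bar> \<le> inf d \<bar>y\<bar>"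
        using d by eventually_elim simp
      ultimately have "z \<le> inf d \<bar>y\<bar>" using z by blast
      then show "z \<le> d" by simp
    qed
  qed
qed

lemma uo_convergent_if_order_convergent:
  assumes "order_convergent UNIV x l G"
  shows "uo_convergent UNIV x l G"
  unfolding uo_convergent_def
proof (intro ballI impI)
  fix y :: 'a assume "0 \<le> y"
  have "\<bar>0 - inf \<bar>x a - l\<bar> y\<bar> \<le> \<bar>l - x a\<bar>" for a
    using \<open>0 \<le> y\<close> by (simp add: abs_minus_commute)
  then show "order_convergent UNIV (\<lambda>a. inf \<bar>x a - l\<bar> y) 0 G"
    using assms unfolding order_convergent_def
    by (blast intro: eventually_mono order_trans)
qed

lemma inf_le_diff_add:
  fixes a y :: "'a::archimedean_vector_lattice"
  assumes "0 \<le> a" "0 \<le> u" "u \<le> y"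
  shows "inf a y \<le> (y - u) + inf a u"
  using assms by (simp add: add_sup_inf_distribs le_infI1 add_increasing)

lemma inf_scaleR_le:
  fixes a :: "'a::archimedean_vector_lattice"
  assumes "1 \<le> c" "0 \<le> a"
  shows "inf a (c *\<^sub>R b) \<le> c *\<^sub>R inf a b"
proof -
  have "(1 / c) *\<^sub>R inf a (c *\<^sub>R b) \<le> (1 / c) *\<^sub>R a"
    using assms(1) by (intro scaleR_left_mono) auto
  moreover have "(1 / c) *\<^sub>R inf a (c *\<^sub>R b) \<le> (1 / c) *\<^sub>R (c *\<^sub>R b)"
    using assms(1) by (intro scaleR_left_mono) auto
  moreover have "(1 / c) *\<^sub>R (c *\<^sub>R b) = b"
    using assms(1) by simp
  moreover have "(1 / c) *\<^sub>R a \<le> 1 *\<^sub>R a"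
    using assms by (intro scaleR_right_mono) auto
  ultimately have "(1 / c) *\<^sub>R inf a (c *\<^sub>R b) \<le> inf a b"
    using order_trans by simp
  then have "c *\<^sub>R ((1 / c) *\<^sub>R inf a (c *\<^sub>R b)) \<le> c *\<^sub>R inf a b"
    using assms(1) by (intro scaleR_left_mono) auto
  then show ?thesis using assms(1) by simp
qed

text \<open>Lets the uniqueness argument test truncations only at levels chosen below a given
  \<open>z\<close>, for instance in \<open>N\<close> or in its disjoint complement, instead of at
  every \<open>y\<close>.\<close>

lemma uo_convergentI_dense:
  fixes x :: "'i \<Rightarrow> 'a::archimedean_vector_lattice"
  assumes G: "G \<noteq> bot"
    and dense: "\<And>z. 0 < z \<Longrightarrow> \<exists>u. 0 < u \<and> u \<le> z \<and> order_convergent UNIV (\<lambda>a. inf \<bar>x a\<bar> u) 0 G"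
  shows "uo_convergent UNIV x 0 G"
  unfolding uo_convergent_def
proof (intro ballI impI)
  fix y :: 'a assume "0 \<le> y"
  have iff: "order_convergent UNIV (\<lambda>a. inf \<bar>x a\<bar> u) 0 G \<longleftrightarrow>
      (\<exists>d. \<forall>\<^sub>F a in G. inf \<bar>x a\<bar> u \<le> d) \<and> (\<forall>z. (\<forall>d. (\<forall>\<^sub>F a in G. inf \<bar>x a\<bar> u \<le> d) \<longrightarrow> z \<le> d) \<longrightarrow> z \<le> 0)"
    if "0 \<le> u" for u
    using order_convergent_0_iff[OF order_ideal_UNIV G, of "\<lambda>a. inf \<bar>x a\<bar> u"] that by simp
  have y: "\<forall>\<^sub>F a in G. inf \<bar>x a\<bar> y \<le> y" by simp
  have main: "z \<le> 0" if z: "\<And>d. (\<forall>\<^sub>F a in G. inf \<bar>x a\<bar> y \<le> d) \<Longrightarrow> z \<le> d" for z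
  proof (rule ccontr)
    assume "\<not> z \<le> 0"
    then have "0 < sup z 0"
      by (metis less_le sup_ge1 sup_ge2)
    then obtain u where u: "0 < u" "u \<le> sup z 0" and "order_convergent UNIV (\<lambda>a. inf \<bar>x a\<bar> u) 0 G"
      using dense by blast
    then have inf0: "w \<le> 0" if "\<And>d. (\<forall>\<^sub>F a in G. inf \<bar>x a\<bar> u \<le> d) \<Longrightarrow> w \<le> d" for w
      using iff[of u] that by auto
    txt \<open>If \<open>k u \<le> y\<close>, then \<open>\<bar>x a\<bar> \<sqinter> y \<le> (y - k u) + (k + 1) (\<bar>x a\<bar> \<sqinter> u)\<close>, so the lower bound \<open>z\<close> satisfies
      \<open>z \<le> y - k u\<close> and \<open>u \<le> sup z 0\<close> yields \<open>(k + 1) u \<le> y\<close>. This contradicts the Archimedean property.\<close>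
    have "of_nat k *\<^sub>R u \<le> y" for k
    proof (induction k)
      case 0
      then show ?case using \<open>0 \<le> y\<close> by simp
    next
      case (Suc k)
      have ku: "0 \<le> of_nat k *\<^sub>R u" using u by (simp add: scaleR_nonneg_nonneg)
      \<comment> \<open>The factor is k + 1 rather than k: \<open>inf_scaleR_le\<close> asks for a
        factor of at least 1, also when k = 0. It is divided out below because \<open>inf0\<close>
        speaks of lower bounds of the \<open>d\<close> themselves, not of their multiples.\<close>
      let ?c = "1 + real k"
      have "(1 / ?c) *\<^sub>R (sup z 0 - (y - of_nat k *\<^sub>R u)) \<le> 0"
      proof (rule inf0)
        fix d assume d: "\<forall>\<^sub>F a in G. inf \<bar>x a\<bar> u \<le> d"
        have "0 \<le> d"
        proof -
          obtain a where "inf \<bar>x a\<bar> u \<le> d"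
            using eventually_happens'[OF G d] by blast
          moreover have "0 \<le> inf \<bar>x a\<bar> u" using u(1) by simp
          ultimately show ?thesis by order
        qed
        have "\<forall>\<^sub>F a in G. inf \<bar>x a\<bar> y \<le> (y - of_nat k *\<^sub>R u) + ?c *\<^sub>R d"
          using d
        proof eventually_elim
          case (elim a)
          have "inf \<bar>x a\<bar> (of_nat k *\<^sub>R u) \<le> inf \<bar>x a\<bar> (?c *\<^sub>R u)"
            using u by (intro inf_mono scaleR_right_mono) auto
          also have "\<dots> \<le> ?c *\<^sub>R inf \<bar>x a\<bar> u"
            by (rule inf_scaleR_le) auto
          also have "\<dots> \<le> ?c *\<^sub>R d"
            using elim by (intro scaleR_left_mono) auto
          finally show ?case
            using inf_le_diff_add[of "\<bar>x a\<bar>" "of_nat k *\<^sub>R u" y] ku Suc.IH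
            by (meson abs_ge_zero add_left_mono order_trans)
        qed
        then have "z \<le> (y - of_nat k *\<^sub>R u) + ?c *\<^sub>R d" by (rule z)
        moreover have "0 \<le> (y - of_nat k *\<^sub>R u) + ?c *\<^sub>R d"
          using Suc.IH \<open>0 \<le> d\<close> by (simp add: scaleR_nonneg_nonneg)
        ultimately have "sup z 0 - (y - of_nat k *\<^sub>R u) \<le> ?c *\<^sub>R d"
          by (simp add: diff_le_eq add.commute)
        then have "(1 / ?c) *\<^sub>R (sup z 0 - (y - of_nat k *\<^sub>R u)) \<le> (1 / ?c) *\<^sub>R (?c *\<^sub>R d)"
          by (intro scaleR_left_mono) auto
        then show "(1 / ?c) *\<^sub>R (sup z 0 - (y - of_nat k *\<^sub>R u)) \<le> d" by simp
      qed
      then have "?c *\<^sub>R ((1 / ?c) *\<^sub>R (sup z 0 - (y - of_nat k *\<^sub>R u))) \<le> ?c *\<^sub>R 0"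
        by (intro scaleR_left_mono) auto
      moreover have "?c *\<^sub>R ((1 / ?c) *\<^sub>R w) = w" for w :: 'a
        by simp
      ultimately have "sup z 0 - (y - of_nat k *\<^sub>R u) \<le> 0"
        by (simp only: scaleR_zero_right)
      then have "sup z 0 + of_nat k *\<^sub>R u \<le> y"
        by (simp only: algebra_simps diff_le_eq add_0_left)
      then show ?case
        using u(2) by (simp add: scaleR_add_left) (meson add_right_mono order_trans)
    qed
    then show False using archimedean[of u y] u(1) by auto
  qed
  then show "order_convergent UNIV (\<lambda>a. inf \<bar>x a - 0\<bar> y) 0 G"
    unfolding diff_0_right iff[OF \<open>0 \<le> y\<close>] using main y by blast
qed

section \<open>Zero neighbourhoods\<close>

definition zero_nbhd :: "'a::zero topology \<Rightarrow> 'a set \<Rightarrow> bool" where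
  "zero_nbhd \<tau> U \<longleftrightarrow> (\<exists>T. openin \<tau> T \<and> 0 \<in> T \<and> T \<subseteq> U)"

lemma zero_nbhd_zero: "zero_nbhd \<tau> U \<Longrightarrow> 0 \<in> U"
  by (auto simp: zero_nbhd_def)

lemma zero_nbhd_mono: "zero_nbhd \<tau> U \<Longrightarrow> U \<subseteq> W \<Longrightarrow> zero_nbhd \<tau> W"
  unfolding zero_nbhd_def by blast

lemma zero_nbhd_Int:
  assumes "zero_nbhd \<tau> U" "zero_nbhd \<tau> W"
  shows "zero_nbhd \<tau> (U \<inter> W)"
proof -
  obtain S T where "openin \<tau> S" "0 \<in> S" "S \<subseteq> U" "openin \<tau> T" "0 \<in> T" "T \<subseteq> W"
    using assms unfolding zero_nbhd_def by blast
  then show ?thesis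
    unfolding zero_nbhd_def by (intro exI[of _ "S \<inter> T"]) auto
qed

lemma limitin_0_iff:
  "limitin \<tau> x 0 G \<longleftrightarrow> 0 \<in> topspace \<tau> \<and> (\<forall>U. zero_nbhd \<tau> U \<longrightarrow> (\<forall>\<^sub>F a in G. x a \<in> U))"
proof -
  have "\<forall>\<^sub>F a in G. x a \<in> U"
    if "\<And>T. openin \<tau> T \<Longrightarrow> 0 \<in> T \<Longrightarrow> \<forall>\<^sub>F a in G. x a \<in> T" "zero_nbhd \<tau> U" for U
  proof -
    obtain T where "openin \<tau> T" "0 \<in> T" "T \<subseteq> U"
      using \<open>zero_nbhd \<tau> U\<close> unfolding zero_nbhd_def by blast
    then show ?thesis
      using that(1)[of T] by (auto elim: eventually_mono)
  qed
  moreover have "zero_nbhd \<tau> T" if "openin \<tau> T" "0 \<in> T" for T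
    using that by (auto simp: zero_nbhd_def)
  ultimately show ?thesis
    unfolding limitin_def by blast
qed

lemma zero_nbhd_solid:
  assumes "locally_solid_topology V \<tau>" "zero_nbhd \<tau> U"
  shows "\<exists>S. solid V S \<and> zero_nbhd \<tau> S \<and> S \<subseteq> U"
proof -
  obtain T where T: "openin \<tau> T" "0 \<in> T" "T \<subseteq> U"
    using assms(2) by (auto simp: zero_nbhd_def)
  then obtain O' S where "openin \<tau> O'" "solid V S" "0 \<in> O'" "O' \<subseteq> S" "S \<subseteq> T"
    using assms(1) unfolding locally_solid_topology_def neighbourhood_base_at_def by meson
  then show ?thesis
    using T unfolding zero_nbhd_def by blast
qed

lemma zero_nbhd_halve:
  fixes \<tau> :: "'a::ab_group_add topology"
  assumes cont: "continuous_map (prod_topology \<tau> \<tau>) \<tau> (\<lambda>(x, y). x + y)" and U: "zero_nbhd \<tau> U"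
  shows "\<exists>S. zero_nbhd \<tau> S \<and> (\<forall>x\<in>S. \<forall>y\<in>S. x + y \<in> U)"
proof -
  obtain T where T: "openin \<tau> T" "0 \<in> T" "T \<subseteq> U"
    using U by (auto simp: zero_nbhd_def)
  have "0 \<in> topspace \<tau>"
    using T openin_subset by blast
  let ?P = "{p \<in> topspace (prod_topology \<tau> \<tau>). (case p of (x, y) \<Rightarrow> x + y) \<in> T}"
  have "openin (prod_topology \<tau> \<tau>) ?P"
    using openin_continuous_map_preimage[OF cont T(1)] .
  moreover have "(0, 0) \<in> ?P"
    using T \<open>0 \<in> topspace \<tau>\<close> by simp
  ultimately obtain A B where AB: "openin \<tau> A" "openin \<tau> B" "0 \<in> A" "0 \<in> B" "A \<times> B \<subseteq> ?P"
    unfolding openin_prod_topology_alt by meson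
  then have "\<forall>x\<in>A \<inter> B. \<forall>y\<in>A \<inter> B. x + y \<in> U"
    using T(3) by auto
  moreover have "zero_nbhd \<tau> (A \<inter> B)"
    using AB unfolding zero_nbhd_def by (intro exI[of _ "A \<inter> B"]) auto
  ultimately show ?thesis by blast
qed

lemma zero_nbhd_solid_halve:
  assumes "locally_solid_topology V \<tau>" "zero_nbhd \<tau> U"
  shows "\<exists>S. solid V S \<and> zero_nbhd \<tau> S \<and> S \<subseteq> U \<and> (\<forall>x\<in>S. \<forall>y\<in>S. x + y \<in> U)"
proof -
  have "continuous_map (prod_topology \<tau> \<tau>) \<tau> (\<lambda>(x, y). x + y)"
    using assms(1) by (auto simp: locally_solid_topology_def linear_topology_def)
  then obtain S where S: "zero_nbhd \<tau> S" "\<forall>x\<in>S. \<forall>y\<in>S. x + y \<in> U"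
    using zero_nbhd_halve assms(2) by blast
  then obtain T where "solid V T" "zero_nbhd \<tau> T" "T \<subseteq> S \<inter> U"
    using zero_nbhd_solid[OF assms(1) zero_nbhd_Int[OF S(1) assms(2)]] by blast
  then show ?thesis using S by blast
qed

section \<open>Zero neighbourhoods and nets determine a group topology\<close>

text \<open>Translations are continuous and have translations as inverses, so the topology is
  recovered from its neighbourhoods of zero.\<close>

lemma openin_iff_zero_nbhd:
  fixes \<tau> :: "'a::ab_group_add topology"
  assumes top: "topspace \<tau> = UNIV"
    and cont: "continuous_map (prod_topology \<tau> \<tau>) \<tau> (\<lambda>(x, y). x + y)"
  shows "openin \<tau> U \<longleftrightarrow> (\<forall>x\<in>U. zero_nbhd \<tau> {y. x + y \<in> U})"
proof -
  have trans: "openin \<tau> {y. x + y \<in> T}" if "openin \<tau> T" for x T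
  proof -
    have "continuous_map \<tau> (prod_topology \<tau> \<tau>) (\<lambda>y. (x, y))"
      using top by (simp add: continuous_map_pairedI)
    then have "continuous_map \<tau> \<tau> ((\<lambda>(x, y). x + y) \<circ> (\<lambda>y. (x, y)))"
      using cont continuous_map_compose by blast
    then show ?thesis
      using openin_continuous_map_preimage[OF _ that, of \<tau>] top by (fastforce simp: o_def)
  qed
  show ?thesis
  proof
    assume "openin \<tau> U"
    then show "\<forall>x\<in>U. zero_nbhd \<tau> {y. x + y \<in> U}"
      unfolding zero_nbhd_def using trans by (metis (mono_tags) add.right_neutral mem_Collect_eq order_refl)
  next
    assume *: "\<forall>x\<in>U. zero_nbhd \<tau> {y. x + y \<in> U}"
    show "openin \<tau> U"
    proof (subst openin_subopen, safe)
      fix x assume "x \<in> U"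
      then obtain T where T: "openin \<tau> T" "0 \<in> T" "T \<subseteq> {y. x + y \<in> U}"
        using * unfolding zero_nbhd_def by blast
      have "openin \<tau> {y. - x + y \<in> T}" by (rule trans[OF T(1)])
      moreover have "x \<in> {y. - x + y \<in> T}" using T by simp
      moreover have "{y. - x + y \<in> T} \<subseteq> U" using T(3) by force
      ultimately show "\<exists>T. openin \<tau> T \<and> x \<in> T \<and> T \<subseteq> U" by blast
    qed
  qed
qed

lemma topology_eq_zero_nbhd:
  fixes \<sigma> \<tau> :: "'a::ab_group_add topology"
  assumes "topspace \<sigma> = UNIV" "continuous_map (prod_topology \<sigma> \<sigma>) \<sigma> (\<lambda>(x, y). x + y)"
    and "topspace \<tau> = UNIV" "continuous_map (prod_topology \<tau> \<tau>) \<tau> (\<lambda>(x, y). x + y)"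
    and "\<And>U. zero_nbhd \<sigma> U \<longleftrightarrow> zero_nbhd \<tau> U"
  shows "\<sigma> = \<tau>"
  unfolding topology_eq using assms by (simp add: openin_iff_zero_nbhd)

text \<open>The test net runs through all pairs of an open zero neighbourhood \<open>T\<close> and a
  point of \<open>T\<close>, ordered by \<open>T\<close> alone. A tail starting at \<open>T\<close>
  visits every point of \<open>T\<close>, so convergence in \<tau> puts a whole \<open>T\<close>
  into \<open>U\<close>. The index type \<open>'a set \<times> 'a\<close> is exactly what this net
  needs.\<close>

lemma zero_nbhd_if_nets:
  fixes \<sigma> \<tau> :: "'a::zero topology"
  assumes "0 \<in> topspace \<sigma>"
    and nets: "\<And>(A::('a set \<times> 'a) set) r x. directed_set A r \<Longrightarrow>
      limitin \<sigma> x 0 (tails A r) \<Longrightarrow> limitin \<tau> x 0 (tails A r)"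
    and "zero_nbhd \<tau> U"
  shows "zero_nbhd \<sigma> U"
proof -
  define A where "A = {(T, v). openin \<sigma> T \<and> 0 \<in> T \<and> v \<in> T}"
  define r where "r = {(p, q). p \<in> A \<and> q \<in> A \<and> fst q \<subseteq> fst p}"
  have dir: "directed_set A r"
    unfolding directed_set_def preorder_on_def
  proof (intro conjI ballI)
    have "(topspace \<sigma>, 0) \<in> A" using assms(1) by (simp add: A_def)
    then show "A \<noteq> {}" by blast
    fix p q assume "p \<in> A" "q \<in> A"
    then show "\<exists>c\<in>A. (p, c) \<in> r \<and> (q, c) \<in> r"
      by (intro bexI[of _ "(fst p \<inter> fst q, 0)"]) (auto simp: A_def r_def)
  qed (auto simp: r_def refl_on_def trans_def)
  have "limitin \<sigma> snd 0 (tails A r)"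
    unfolding limitin_def eventually_tails[OF dir]
  proof (intro conjI allI impI assms(1))
    fix T assume "openin \<sigma> T \<and> 0 \<in> T"
    then show "\<exists>a\<in>A. \<forall>b\<in>A. (a, b) \<in> r \<longrightarrow> snd b \<in> T"
      by (intro bexI[of _ "(T, 0)"]) (auto simp: A_def r_def)
  qed
  then have "limitin \<tau> snd 0 (tails A r)" by (rule nets[OF dir])
  then obtain p where p: "p \<in> A" "\<And>q. q \<in> A \<Longrightarrow> (p, q) \<in> r \<Longrightarrow> snd q \<in> U"
    using assms(3) unfolding limitin_0_iff eventually_tails[OF dir] by blast
  have "fst p \<subseteq> U"
  proof
    fix v assume "v \<in> fst p"
    then show "v \<in> U" using p(1) p(2)[of "(fst p, v)"] by (auto simp: A_def r_def)
  qed
  then show ?thesis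
    using p(1) unfolding zero_nbhd_def A_def by auto
qed

lemma Hausdorff_zero_nbhd:
  fixes \<tau> :: "'a::zero topology"
  assumes "Hausdorff_space \<tau>" "x \<in> topspace \<tau>" "0 \<in> topspace \<tau>" "x \<noteq> 0"
  shows "\<exists>U. zero_nbhd \<tau> U \<and> x \<notin> U"
proof -
  obtain A B where "openin \<tau> A" "openin \<tau> B" "x \<in> A" "0 \<in> B" "disjnt A B"
    using assms unfolding Hausdorff_space_def by meson
  then show ?thesis
    unfolding zero_nbhd_def by (intro exI[of _ B]) (auto simp: disjnt_iff)
qed

text \<open>All approximation arguments use the o-Lebesgue property in this form: \<open>D\<close>,
  indexed by itself, is a net that converges to zero in order.\<close>

lemma o_Lebesgue_directed_to_zero:
  assumes \<tau>: "o_Lebesgue_topology V \<tau>" and D: "directed_to_zero V D" and U: "zero_nbhd \<tau> U" and "0 \<in> V"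
  shows "\<exists>d\<in>D. d \<in> U"
proof -
  define r where "r = {(a, b). a \<in> D \<and> b \<in> D \<and> b \<le> a}"
  have dir: "directed_set D r"
    unfolding directed_set_def preorder_on_def
  proof (intro conjI ballI)
    fix a b assume "a \<in> D" "b \<in> D"
    moreover obtain c where "c \<in> D" "c \<le> a" "c \<le> b"
      using D calculation unfolding directed_to_zero_def by blast
    ultimately show "\<exists>c\<in>D. (a, c) \<in> r \<and> (b, c) \<in> r"
      by (auto simp: r_def)
  qed (use D in \<open>auto simp: directed_to_zero_def r_def refl_on_def trans_def\<close>)
  have "decreasing_to V D r (\<lambda>d. d) 0"
    unfolding decreasing_to_def
  proof (intro conjI)
    show "isGlb V ((\<lambda>d. d) ` D) 0"
      using D \<open>0 \<in> V\<close>
      by (intro isGlbI2 isLbI setgeI setleI) (auto simp: isLb_def setge_def directed_to_zero_def)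
  qed (use D in \<open>auto simp: r_def directed_to_zero_def\<close>)
  with dir have "order_convergent V (\<lambda>d. d) 0 (tails D r)"
  proof (rule order_convergentI)
    show "\<forall>b\<in>D. \<forall>\<^sub>F a in tails D r. \<bar>0 - a\<bar> \<le> b"
    proof
      fix b assume "b \<in> D"
      moreover have "\<bar>0 - a\<bar> \<le> b" if "(b, a) \<in> r" for a
        using D that by (simp add: directed_to_zero_def r_def)
      ultimately show "\<forall>\<^sub>F a in tails D r. \<bar>0 - a\<bar> \<le> b"
        unfolding eventually_tails[OF dir] by blast
    qed
  qed
  then have "limitin \<tau> (\<lambda>d. d) 0 (tails D r)"
    using D by (intro o_Lebesgue_any_net[OF \<tau> dir]) (auto simp: directed_to_zero_def \<open>0 \<in> V\<close>)
  \<comment> \<open>The conjunct \<open>d \<in> D\<close> records that tails stay in the index set;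
    without it the witness would merely be an element of \<open>U\<close>.\<close>
  then have "\<forall>\<^sub>F d in tails D r. d \<in> U \<and> d \<in> D"
    using U unfolding limitin_0_iff eventually_tails[OF dir] by blast
  then show ?thesis
    using eventually_happens'[OF tails_neq_bot[OF dir]] by blast
qed

lemma o_Lebesgue_if_uo_Lebesgue:
  "uo_Lebesgue_topology UNIV \<tau> \<Longrightarrow> o_Lebesgue_topology UNIV \<tau>"
  unfolding o_Lebesgue_topology_def uo_Lebesgue_topology_def
  using uo_convergent_if_order_convergent by blast

section \<open>Locally solid topologies from a base at zero\<close>

lemma zero_nbhd_add_closed_base:
  fixes \<B> :: "'a::ab_group_add set set"
  assumes "\<B> \<noteq> {}" and zero: "\<And>B. B \<in> \<B> \<Longrightarrow> 0 \<in> B"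
    and inter: "\<And>A B. A \<in> \<B> \<Longrightarrow> B \<in> \<B> \<Longrightarrow> \<exists>C\<in>\<B>. C \<subseteq> A \<inter> B"
    and halve: "\<And>A. A \<in> \<B> \<Longrightarrow> \<exists>B\<in>\<B>. \<forall>x\<in>B. \<forall>y\<in>B. x + y \<in> A"
  obtains \<tau> where "topspace \<tau> = UNIV"
    "\<And>U. openin \<tau> U \<longleftrightarrow> (\<forall>x\<in>U. \<exists>B\<in>\<B>. \<forall>b\<in>B. x + b \<in> U)"
    "\<And>x B. B \<in> \<B> \<Longrightarrow> \<exists>T. openin \<tau> T \<and> x \<in> T \<and> (\<forall>t\<in>T. t - x \<in> B)"
proof -
  let ?P = "\<lambda>U. \<forall>x\<in>U. \<exists>B\<in>\<B>. \<forall>b\<in>B. x + b \<in> U"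
  have "istopology ?P"
    unfolding istopology_def
  proof (intro conjI allI impI ballI)
    fix S T x assume ST: "?P S" "?P T" and x: "x \<in> S \<inter> T"
    then obtain A B where "A \<in> \<B>" "\<forall>b\<in>A. x + b \<in> S" "B \<in> \<B>" "\<forall>b\<in>B. x + b \<in> T"
      by blast
    then show "\<exists>B\<in>\<B>. \<forall>b\<in>B. x + b \<in> S \<inter> T"
      using inter[of A B] by blast
  next
    fix K x assume "\<forall>U\<in>K. ?P U" "x \<in> \<Union>K"
    then show "\<exists>B\<in>\<B>. \<forall>b\<in>B. x + b \<in> \<Union>K" by (meson Union_iff)
  qed
  then have op: "openin (topology ?P) U \<longleftrightarrow> ?P U" for U
    by (simp add: topology_inverse')
  show ?thesis
  proof (rule that)
    have "openin (topology ?P) UNIV"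
      unfolding op using assms(1) by blast
    then show "topspace (topology ?P) = UNIV"
      using openin_subset by blast
    show "openin (topology ?P) U \<longleftrightarrow> ?P U" for U by (rule op)
    fix x B assume B: "B \<in> \<B>"
    \<comment> \<open>This is the interior of the translate of \<open>B\<close> by \<open>x\<close>;
      halving is what makes it open.\<close>
    let ?T = "{t. \<exists>A\<in>\<B>. \<forall>a\<in>A. t - x + a \<in> B}"
    have "openin (topology ?P) ?T"
      unfolding op
    proof safe
      fix t A assume A: "A \<in> \<B>" "\<forall>a\<in>A. t - x + a \<in> B"
      obtain C where C: "C \<in> \<B>" "\<forall>x\<in>C. \<forall>y\<in>C. x + y \<in> A" using halve[OF A(1)] by blast
      then have "\<forall>b\<in>C. \<forall>a\<in>C. t + b - x + a \<in> B"
        using A(2) by (metis (no_types, lifting) add.assoc add_diff_eq diff_add_eq)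
      then show "\<exists>B'\<in>\<B>. \<forall>b\<in>B'. t + b \<in> ?T" using C(1) by blast
    qed
    moreover have "x \<in> ?T" using B by auto
    moreover have "\<forall>t\<in>?T. t - x \<in> B" using zero by fastforce
    ultimately show "\<exists>T. openin (topology ?P) T \<and> x \<in> T \<and> (\<forall>t\<in>T. t - x \<in> B)" by blast
  qed
qed

text \<open>Halving gives continuity of addition. Scalar multiplication is handled by writing
  \<open>d t\<close> as \<open>c x + (d - c) x + d (t - x)\<close>: the middle term is small by
  absorption, the last one by solidity and \<open>scale_small\<close>.\<close>

lemma locally_solid_topology_of_base:
  fixes \<B> :: "'a::archimedean_vector_lattice set set"
  assumes ne: "\<B> \<noteq> {}" and zero: "\<And>B. B \<in> \<B> \<Longrightarrow> 0 \<in> B"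
    and inter: "\<And>A B. A \<in> \<B> \<Longrightarrow> B \<in> \<B> \<Longrightarrow> \<exists>C\<in>\<B>. C \<subseteq> A \<inter> B"
    and halve: "\<And>A. A \<in> \<B> \<Longrightarrow> \<exists>B\<in>\<B>. \<forall>x\<in>B. \<forall>y\<in>B. x + y \<in> A"
    and sol: "\<And>B. B \<in> \<B> \<Longrightarrow> solid UNIV B"
    and absorb: "\<And>B x. B \<in> \<B> \<Longrightarrow> \<exists>e>0. \<forall>c. \<bar>c\<bar> < e \<longrightarrow> c *\<^sub>R x \<in> B"
  obtains \<tau> where "locally_solid_topology UNIV \<tau>" "\<And>U. zero_nbhd \<tau> U \<longleftrightarrow> (\<exists>B\<in>\<B>. B \<subseteq> U)"
    "\<And>x l G. limitin \<tau> x l G \<longleftrightarrow> (\<forall>B\<in>\<B>. \<forall>\<^sub>F a in G. x a - l \<in> B)"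
proof -
  obtain \<tau> where top: "topspace \<tau> = UNIV"
    and op: "\<And>U. openin \<tau> U \<longleftrightarrow> (\<forall>x\<in>U. \<exists>B\<in>\<B>. \<forall>b\<in>B. x + b \<in> U)"
    and nbhd: "\<And>x B. B \<in> \<B> \<Longrightarrow> \<exists>T. openin \<tau> T \<and> x \<in> T \<and> (\<forall>t\<in>T. t - x \<in> B)"
    using zero_nbhd_add_closed_base[OF ne zero inter halve] by metis
  have add: "continuous_map (prod_topology \<tau> \<tau>) \<tau> (\<lambda>(x, y). x + y)"
    unfolding continuous_map_def
  proof (intro conjI allI impI)
    fix U assume U: "openin \<tau> U"
    show "openin (prod_topology \<tau> \<tau>) {p \<in> topspace (prod_topology \<tau> \<tau>). (case p of (x, y) \<Rightarrow> x + y) \<in> U}"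
      unfolding openin_prod_topology_alt
    proof (intro allI impI)
      fix x y assume "(x, y) \<in> {p \<in> topspace (prod_topology \<tau> \<tau>). (case p of (x, y) \<Rightarrow> x + y) \<in> U}"
      then have "x + y \<in> U" by simp
      then obtain A where A: "A \<in> \<B>" "\<forall>b\<in>A. x + y + b \<in> U" using U op by blast
      obtain B where B: "B \<in> \<B>" "\<forall>x\<in>B. \<forall>y\<in>B. x + y \<in> A" using halve[OF A(1)] by blast
      obtain S T where S: "openin \<tau> S" "x \<in> S" "\<forall>t\<in>S. t - x \<in> B"
        and T: "openin \<tau> T" "y \<in> T" "\<forall>t\<in>T. t - y \<in> B"
        using nbhd[OF B(1)] by meson
      have "s + t \<in> U" if "s \<in> S" "t \<in> T" for s t
      proof -
        have "(s - x) + (t - y) \<in> A" using B S T that by blast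
        then have "x + y + ((s - x) + (t - y)) \<in> U" using A by blast
        then show ?thesis by (simp add: algebra_simps)
      qed
      then show "\<exists>S T. openin \<tau> S \<and> openin \<tau> T \<and> x \<in> S \<and> y \<in> T \<and>
          S \<times> T \<subseteq> {p \<in> topspace (prod_topology \<tau> \<tau>). (case p of (x, y) \<Rightarrow> x + y) \<in> U}"
        using S T top by (intro exI[of _ S] exI[of _ T]) auto
    qed
  qed (simp add: top)
  \<comment> \<open>Halving n times takes care of the factor 2^n, and solidity passes to any scalar
    of smaller absolute value.\<close>
  have scale_small: "\<exists>C\<in>\<B>. \<forall>x\<in>C. c *\<^sub>R x \<in> B" if B: "B \<in> \<B>" for c B
  proof -
    have "\<exists>C\<in>\<B>. \<forall>x\<in>C. of_nat (2 ^ n) *\<^sub>R x \<in> B" for n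
    proof (induction n)
      case 0
      then show ?case using B by auto
    next
      case (Suc n)
      then obtain C where C: "C \<in> \<B>" "\<forall>x\<in>C. of_nat (2 ^ n) *\<^sub>R x \<in> B" by blast
      obtain D where D: "D \<in> \<B>" "\<forall>x\<in>D. \<forall>y\<in>D. x + y \<in> C" using halve[OF C(1)] by blast
      have "of_nat (2 ^ Suc n) *\<^sub>R x \<in> B" if "x \<in> D" for x
      proof -
        have "of_nat (2 ^ n) *\<^sub>R (x + x) \<in> B" using C D that by blast
        then show ?thesis by (simp add: scaleR_2[symmetric] mult.commute)
      qed
      then show ?case using D(1) by blast
    qed
    moreover obtain n :: nat where n: "\<bar>c\<bar> \<le> \<bar>of_nat (2 ^ n)\<bar>"
      using real_arch_pow[of 2 "\<bar>c\<bar>"] by (auto intro: less_imp_le)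
    ultimately obtain C where C: "C \<in> \<B>" "\<forall>x\<in>C. of_nat (2 ^ n) *\<^sub>R x \<in> B" by blast
    have "c *\<^sub>R x \<in> B" if "x \<in> C" for x
      using abs_scaleR_mono[OF n, of x] sol[OF B] C(2) that
      unfolding solid_def by blast
    then show ?thesis using C(1) by blast
  qed
  have scale: "continuous_map (prod_topology euclideanreal \<tau>) \<tau> (\<lambda>(c, x). c *\<^sub>R x)"
    unfolding continuous_map_def
  proof (intro conjI allI impI)
    fix U assume U: "openin \<tau> U"
    show "openin (prod_topology euclideanreal \<tau>) {p \<in> topspace (prod_topology euclideanreal \<tau>). (case p of (c, x) \<Rightarrow> c *\<^sub>R x) \<in> U}"
      unfolding openin_prod_topology_alt
    proof (intro allI impI)
      fix c x assume "(c, x) \<in> {p \<in> topspace (prod_topology euclideanreal \<tau>). (case p of (c, x) \<Rightarrow> c *\<^sub>R x) \<in> U}"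
      then have "c *\<^sub>R x \<in> U" by simp
      then obtain A where A: "A \<in> \<B>" "\<forall>b\<in>A. c *\<^sub>R x + b \<in> U" using U op by blast
      obtain B where B: "B \<in> \<B>" "\<forall>x\<in>B. \<forall>y\<in>B. x + y \<in> A" using halve[OF A(1)] by blast
      obtain e where e: "e > 0" "\<And>d. \<bar>d\<bar> < e \<Longrightarrow> d *\<^sub>R x \<in> B" using absorb[OF B(1)] by blast
      \<comment> \<open>The constant |c| + e bounds |d| for all scalars \<open>d\<close> in the ball
        around \<open>c\<close>.\<close>
      obtain C where C: "C \<in> \<B>" "\<forall>x\<in>C. (\<bar>c\<bar> + e) *\<^sub>R x \<in> B" using scale_small[OF B(1)] by blast
      obtain T where T: "openin \<tau> T" "x \<in> T" "\<forall>t\<in>T. t - x \<in> C" using nbhd[OF C(1)] by meson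
      have "d *\<^sub>R t \<in> U" if "d \<in> ball c e" "t \<in> T" for d t
      proof -
        have d: "\<bar>d - c\<bar> < e" using that by (simp add: dist_real_def abs_minus_commute)
        have "\<bar>d *\<^sub>R (t - x)\<bar> \<le> \<bar>(\<bar>c\<bar> + e) *\<^sub>R (t - x)\<bar>"
          using d e(1) by (intro abs_scaleR_mono) auto
        then have "d *\<^sub>R (t - x) \<in> B"
          using C(2) T(3) that sol[OF B(1)] unfolding solid_def by blast
        moreover have "(d - c) *\<^sub>R x \<in> B" using e d by blast
        ultimately have "(d - c) *\<^sub>R x + d *\<^sub>R (t - x) \<in> A" using B by blast
        then have "c *\<^sub>R x + ((d - c) *\<^sub>R x + d *\<^sub>R (t - x)) \<in> U" using A by blast
        then show ?thesis by (simp add: algebra_simps)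
      qed
      then show "\<exists>S T. openin euclideanreal S \<and> openin \<tau> T \<and> c \<in> S \<and> x \<in> T \<and>
          S \<times> T \<subseteq> {p \<in> topspace (prod_topology euclideanreal \<tau>). (case p of (c, x) \<Rightarrow> c *\<^sub>R x) \<in> U}"
        using T top e(1) by (intro exI[of _ "ball c e"] exI[of _ T]) auto
    qed
  qed (simp add: top)
  have zn: "zero_nbhd \<tau> U \<longleftrightarrow> (\<exists>B\<in>\<B>. B \<subseteq> U)" for U
  proof
    assume "zero_nbhd \<tau> U"
    then obtain T where T: "openin \<tau> T" "0 \<in> T" "T \<subseteq> U" unfolding zero_nbhd_def by blast
    then obtain B where "B \<in> \<B>" "\<forall>b\<in>B. 0 + b \<in> T" unfolding op by blast
    then show "\<exists>B\<in>\<B>. B \<subseteq> U" using T(3) by auto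
  next
    assume "\<exists>B\<in>\<B>. B \<subseteq> U"
    then show "zero_nbhd \<tau> U" unfolding zero_nbhd_def using nbhd[of _ 0] by (metis diff_zero subset_iff)
  qed
  have "locally_solid_topology UNIV \<tau>"
    unfolding locally_solid_topology_def linear_topology_def neighbourhood_base_at_def
  proof (intro conjI allI impI top add scale)
    fix W assume "openin \<tau> W \<and> 0 \<in> W"
    then have "zero_nbhd \<tau> W" by (auto simp: zero_nbhd_def)
    then obtain B where B: "B \<in> \<B>" "B \<subseteq> W" using zn by blast
    then have "zero_nbhd \<tau> B" using zn by blast
    then show "\<exists>U V. openin \<tau> U \<and> solid UNIV V \<and> 0 \<in> U \<and> U \<subseteq> V \<and> V \<subseteq> W"
      using B sol unfolding zero_nbhd_def by blast
  qed
  moreover have "limitin \<tau> x l G \<longleftrightarrow> (\<forall>B\<in>\<B>. \<forall>\<^sub>F a in G. x a - l \<in> B)" for x l G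
  proof
    assume lim: "limitin \<tau> x l G"
    show "\<forall>B\<in>\<B>. \<forall>\<^sub>F a in G. x a - l \<in> B"
    proof
      fix B assume "B \<in> \<B>"
      then obtain T where T: "openin \<tau> T" "l \<in> T" "\<forall>t\<in>T. t - l \<in> B" using nbhd by meson
      show "\<forall>\<^sub>F a in G. x a - l \<in> B"
        using limitinD[OF lim T(1,2)] by eventually_elim (use T(3) in blast)
    qed
  next
    assume *: "\<forall>B\<in>\<B>. \<forall>\<^sub>F a in G. x a - l \<in> B"
    show "limitin \<tau> x l G"
      unfolding limitin_def
    proof (intro conjI allI impI)
      fix U assume "openin \<tau> U \<and> l \<in> U"
      then obtain B where B: "B \<in> \<B>" "\<forall>b\<in>B. l + b \<in> U" using op by blast
      have "\<forall>\<^sub>F a in G. x a - l \<in> B" using * B by blast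
      then show "\<forall>\<^sub>F a in G. x a \<in> U"
        by eventually_elim (use B(2) in force)
    qed (simp add: top)
  qed
  ultimately show ?thesis using that zn by blast
qed

section \<open>Uniqueness of uo-Lebesgue topologies\<close>

text \<open>These are the sequences known from the metrization of topological groups, with solid
  members. The halving condition makes the intersection an ideal and keeps series under
  control.\<close>

definition normal_sequence :: "'a::archimedean_vector_lattice topology \<Rightarrow> (nat \<Rightarrow> 'a set) \<Rightarrow> bool" where
  "normal_sequence \<tau> V \<longleftrightarrow> (\<forall>n. solid UNIV (V n) \<and> zero_nbhd \<tau> (V n) \<and>
     (\<forall>x\<in>V (Suc n). \<forall>y\<in>V (Suc n). x + y \<in> V n))"

lemma normal_sequence_exists:
  assumes \<tau>: "locally_solid_topology UNIV \<tau>" and U: "zero_nbhd \<tau> U"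
  obtains V where "normal_sequence \<tau> V" "V 0 \<subseteq> U"
proof -
  have "\<exists>V. \<forall>n. (solid UNIV (V n) \<and> zero_nbhd \<tau> (V n) \<and> (n = 0 \<longrightarrow> V n \<subseteq> U)) \<and>
      (\<forall>x\<in>V (Suc n). \<forall>y\<in>V (Suc n). x + y \<in> V n)"
  proof (rule dependent_nat_choice)
    show "\<exists>S. solid UNIV S \<and> zero_nbhd \<tau> S \<and> ((0::nat) = 0 \<longrightarrow> S \<subseteq> U)"
      using zero_nbhd_solid[OF \<tau> U] by blast
    show "\<exists>T. (solid UNIV T \<and> zero_nbhd \<tau> T \<and> (Suc n = 0 \<longrightarrow> T \<subseteq> U)) \<and> (\<forall>x\<in>T. \<forall>y\<in>T. x + y \<in> S)"
      if S: "solid UNIV S \<and> zero_nbhd \<tau> S \<and> (n = 0 \<longrightarrow> S \<subseteq> U)" for S n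
    proof -
      obtain T where "solid UNIV T" "zero_nbhd \<tau> T" "\<forall>x\<in>T. \<forall>y\<in>T. x + y \<in> S"
        using zero_nbhd_solid_halve[OF \<tau>, of S] S by blast
      then show ?thesis by (intro exI[of _ T]) simp
    qed
  qed
  then show ?thesis using that unfolding normal_sequence_def by blast
qed

lemma normal_sequence_le:
  "normal_sequence \<tau> V \<Longrightarrow> y \<in> V n \<Longrightarrow> \<bar>x\<bar> \<le> \<bar>y\<bar> \<Longrightarrow> x \<in> V n"
  unfolding normal_sequence_def solid_def by blast

lemma normal_sequence_add:
  "normal_sequence \<tau> V \<Longrightarrow> x \<in> V (Suc n) \<Longrightarrow> y \<in> V (Suc n) \<Longrightarrow> x + y \<in> V n"
  unfolding normal_sequence_def by blast

lemma normal_sequence_zero: "normal_sequence \<tau> V \<Longrightarrow> 0 \<in> V n"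
  unfolding normal_sequence_def using zero_nbhd_zero by blast

lemma normal_sequence_Int:
  assumes "normal_sequence \<tau> V" "normal_sequence \<tau> W"
  shows "normal_sequence \<tau> (\<lambda>n. V n \<inter> W n)"
proof -
  have "solid UNIV (V n \<inter> W n)" for n
    using assms normal_sequence_le unfolding solid_def by (metis IntD1 IntD2 IntI subset_UNIV)
  moreover have "zero_nbhd \<tau> (V n \<inter> W n)" for n
    using assms zero_nbhd_Int unfolding normal_sequence_def by blast
  ultimately show ?thesis
    using assms normal_sequence_add unfolding normal_sequence_def[of _ "\<lambda>n. V n \<inter> W n"]
    by (metis IntD1 IntD2 IntI)
qed

text \<open>Peeling off the first term, which lies in \<open>V (Suc n)\<close>, leaves a sum in
  \<open>V (Suc n)\<close> by induction. Summation starts at \<open>Suc n\<close> so that the result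
  lands in \<open>V n\<close>.\<close>

lemma normal_sequence_sum:
  assumes V: "normal_sequence \<tau> V" and e: "\<And>k. e k \<in> V k"
  shows "(\<Sum>k\<in>{n<..n + m}. e k) \<in> V n"
proof (induction m arbitrary: n)
  case 0
  then show ?case using normal_sequence_zero[OF V] by simp
next
  case (Suc m)
  have "{n<..n + Suc m} = insert (Suc n) {Suc n<..Suc n + m}" by auto
  then have "(\<Sum>k\<in>{n<..n + Suc m}. e k) = e (Suc n) + (\<Sum>k\<in>{Suc n<..Suc n + m}. e k)" by simp
  then show ?case
    using normal_sequence_add[OF V e[of "Suc n"] Suc.IH[of "Suc n"]] by simp
qed

lemma order_ideal_normal_Inter:
  assumes V: "normal_sequence \<tau> V"
  shows "order_ideal (\<Inter>n. V n)"
proof (rule order_idealI)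
  show "x + y \<in> (\<Inter>n. V n)" if "x \<in> (\<Inter>n. V n)" "y \<in> (\<Inter>n. V n)" for x y
    using that by (auto intro: normal_sequence_add[OF V])
  show "x \<in> (\<Inter>n. V n)" if "y \<in> (\<Inter>n. V n)" "\<bar>x\<bar> \<le> \<bar>y\<bar>" for x y
    using that by (auto intro: normal_sequence_le[OF V])
qed (simp add: normal_sequence_zero[OF V])

text \<open>If nothing positive below \<open>z\<close> were disjoint from the intersection, the
  intersection would be order dense below \<open>z\<close>. Then \<open>z\<close> would be
  approximated by its elements up to every \<open>V (Suc n)\<close>, and so would belong to
  it.\<close>

lemma normal_Inter_order_closed:
  assumes \<tau>: "o_Lebesgue_topology UNIV \<tau>" and V: "normal_sequence \<tau> V" and z: "0 < z" "z \<notin> (\<Inter>n. V n)"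
  shows "\<exists>u. 0 < u \<and> u \<le> z \<and> u \<in> disjoint_complement (\<Inter>n. V n)"
proof (rule ccontr)
  let ?N = "\<Inter>n. V n"
  assume *: "\<not> ?thesis"
  have N: "order_ideal ?N" by (rule order_ideal_normal_Inter[OF V])
  have "directed_to_zero UNIV {z - w |w. w \<in> ?N \<and> 0 \<le> w \<and> w \<le> z}"
  proof (rule directed_to_zero_differences[OF order_ideal_UNIV UNIV_I N])
    show "\<exists>u\<in>?N. 0 < u \<and> u \<le> v" if "0 < v" "v \<le> z" for v
      using exists_below_in_or_disjoint[OF N that(1)] * that by blast
  qed (use z in simp)
  note D = o_Lebesgue_directed_to_zero[OF \<tau> this _ UNIV_I]
  have "z \<in> V n" for n
  proof -
    have "zero_nbhd \<tau> (V (Suc n))" using V by (auto simp: normal_sequence_def)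
    from D[OF this] obtain w where "w \<in> ?N" "z - w \<in> V (Suc n)" by blast
    then have "(z - w) + w \<in> V n" by (intro normal_sequence_add[OF V]) auto
    then show ?thesis by simp
  qed
  then show False using z(2) by blast
qed

lemma directed_set_nat: "directed_set UNIV {(m, n::nat). m \<le> n}"
  unfolding directed_set_def preorder_on_def
  by (auto simp: refl_on_def trans_def intro: max.cobounded1 max.cobounded2)

text \<open>For every n some tail of the truncated sequence has an upper bound in
  \<open>V n\<close>. The positive part of a lower bound of all eventual upper bounds thus lies in
  every \<open>V n\<close>; it also lies below \<open>y\<close>, which is disjoint from the
  intersection.\<close>

lemma normal_sequence_order_convergent:
  fixes y :: "'a::archimedean_vector_lattice"
  assumes \<tau>: "o_Lebesgue_topology UNIV \<tau>" and V: "normal_sequence \<tau> V"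
    and q: "\<And>n. q n \<in> V n" and y: "0 \<le> y" "y \<in> disjoint_complement (\<Inter>n. V n)"
  shows "order_convergent UNIV (\<lambda>n. inf \<bar>q n\<bar> y) 0 (tails UNIV {(m, n). m \<le> n})"
proof -
  let ?G = "tails UNIV {(m, n::nat). m \<le> n}"
  let ?N = "\<Inter>n. V n"
  define e where "e n = inf \<bar>q n\<bar> y" for n
  have e: "0 \<le> e n" "e n \<le> y" "e n \<in> V n" for n
    using y(1) normal_sequence_le[OF V q[of n], of "e n"] by (auto simp: e_def)
  note iff = order_convergent_0_iff[OF order_ideal_UNIV tails_neq_bot[OF directed_set_nat], of e, OF e(1)]
  have "order_convergent UNIV e 0 ?G"
    unfolding iff
  proof (intro conjI ballI impI)
    show "\<exists>d\<in>UNIV. \<forall>\<^sub>F n in ?G. e n \<le> d" using e(2) by (intro bexI[of _ y]) auto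
    fix z assume z: "\<forall>d\<in>UNIV. (\<forall>\<^sub>F n in ?G. e n \<le> d) \<longrightarrow> z \<le> d"
    have zV: "sup z 0 \<in> V n" for n
    proof -
      txt \<open>Without order completeness the supremum of the \<open>e k\<close> over \<open>k > n\<close> need not exist; the
        Lebesgue property still provides an upper bound \<open>u\<close> in \<open>V n\<close>, close to some partial sum.\<close>
      let ?s = "\<lambda>m. \<Sum>k\<in>{Suc n<..Suc n + m}. e k"
      \<comment> \<open>Capping at \<open>y\<close> supplies the bound that
        \<open>directed_to_zero_upper_bounds\<close> requires. Each \<open>e k\<close> with
        \<open>k > Suc n\<close> survives the cap, because \<open>e k \<le> y\<close>.\<close>
      let ?S = "{s. 0 \<le> s \<and> s \<le> y \<and> (\<exists>m. s \<le> ?s m)}"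
      have mono: "?s m \<le> ?s m'" if "m \<le> m'" for m m'
        using that e(1) by (intro sum_mono2) auto
      have "directed_to_zero UNIV {u - s | u s. s \<in> ?S \<and> (\<forall>t\<in>?S. t \<le> u)}"
      proof (rule directed_to_zero_upper_bounds)
        show "?S \<noteq> {}" using y(1) by (auto intro!: exI[of _ 0])
        show "s \<le> y" if "s \<in> ?S" for s using that by simp
        fix s t assume st: "s \<in> ?S" "t \<in> ?S"
        then obtain m m' where m: "s \<le> ?s m" "t \<le> ?s m'" by blast
        have "s \<le> ?s (max m m')" "t \<le> ?s (max m m')"
          using m mono[of m "max m m'"] mono[of m' "max m m'"] by (auto intro: order_trans)
        then have "sup s t \<in> ?S" using st by (auto intro: le_supI1)
        then show "\<exists>c\<in>?S. s \<le> c \<and> t \<le> c" by (intro bexI[of _ "sup s t"]) auto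
      qed
      moreover have "zero_nbhd \<tau> (V (Suc n))" using V by (auto simp: normal_sequence_def)
      ultimately have "\<exists>d\<in>{u - s | u s. s \<in> ?S \<and> (\<forall>t\<in>?S. t \<le> u)}. d \<in> V (Suc n)"
        by (rule o_Lebesgue_directed_to_zero[OF \<tau> _ _ UNIV_I])
      then obtain u s where us: "u - s \<in> V (Suc n)" "s \<in> ?S" "\<forall>t\<in>?S. t \<le> u"
        by blast
      then obtain m where m: "0 \<le> s" "s \<le> ?s m" by blast
      \<comment> \<open>The sum starts at n + 2 and so lies in \<open>V (Suc n)\<close>; the
        remaining halving is spent on the gap \<open>u - s\<close>.\<close>
      have "?s m \<in> V (Suc n)" by (rule normal_sequence_sum[OF V e(3)])
      moreover have "\<bar>s\<bar> \<le> \<bar>?s m\<bar>"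
        using m(1) order_trans[OF m(2) abs_ge_self] by simp
      ultimately have "s \<in> V (Suc n)" by (rule normal_sequence_le[OF V])
      then have "(u - s) + s \<in> V n" by (rule normal_sequence_add[OF V us(1)])
      then have "u \<in> V n" by simp
      have "e k \<le> u" if "Suc n < k" for k
      proof -
        \<comment> \<open>Taking k summands is generous: it is enough that the range reaches the
          index k.\<close>
        have "e k \<le> ?s k" using sum_mono2[of "{Suc n<..Suc n + k}" "{k}" e] that e(1) by simp
        then show ?thesis using us(3) e by blast
      qed
      then have "\<forall>\<^sub>F k in ?G. e k \<le> u"
        unfolding eventually_tails[OF directed_set_nat] by (intro bexI[of _ "Suc (Suc n)"]) auto
      then have "z \<le> u" using z by blast
      then have "\<bar>sup z 0\<bar> \<le> \<bar>u\<bar>"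
        using m(1) us(2,3) by (auto simp: abs_ge_self intro: order_trans)
      then show ?thesis using normal_sequence_le[OF V \<open>u \<in> V n\<close>] by blast
    qed
    then have "sup z 0 \<in> ?N" by blast
    moreover have "sup z 0 \<le> y"
      using z e(2) y(1) by (simp add: eventually_True)
    then have "inf \<bar>sup z 0\<bar> \<bar>y\<bar> = sup z 0"
      using y(1) by (simp add: inf.absorb1 sup.absorb1)
    ultimately have "sup z 0 = 0"
      using y(2) unfolding disjoint_complement_def by force
    then show "z \<le> 0" by (metis sup_ge1)
  qed
  then show ?thesis unfolding e_def[abs_def] .
qed

section \<open>Comparison of two uo-Lebesgue topologies\<close>

text \<open>The net of chosen points is indexed by the intersections themselves under reverse
  inclusion; intersecting two normal sequences termwise makes this family directed. The Hausdorff
  property yields, for each \<open>z > 0\<close>, a sequence whose intersection misses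
  \<open>z\<close>.\<close>

lemma uo_Lebesgue_zero_nbhd_contains_normal_Inter:
  fixes \<sigma> \<tau> :: "'a::archimedean_vector_lattice topology"
  assumes \<sigma>: "uo_Lebesgue_topology UNIV \<sigma>" "Hausdorff_space \<sigma>" and \<tau>: "uo_Lebesgue_topology UNIV \<tau>"
    and W: "zero_nbhd \<tau> W"
  shows "\<exists>V. normal_sequence \<sigma> V \<and> (\<Inter>n. V n) \<subseteq> W"
proof (rule ccontr)
  assume *: "\<not> ?thesis"
  have ls: "locally_solid_topology UNIV \<sigma>" and top: "topspace \<sigma> = UNIV"
    using \<sigma>(1) by (auto simp: uo_Lebesgue_topology_def locally_solid_topology_def linear_topology_def)
  note leb = o_Lebesgue_if_uo_Lebesgue[OF \<sigma>(1)]
  define A where "A = {N. \<exists>V. normal_sequence \<sigma> V \<and> N = (\<Inter>n. V n)}"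
  define r where "r = {(M, N). M \<in> A \<and> N \<in> A \<and> N \<subseteq> M}"
  have Int_A: "M \<inter> N \<in> A" if "M \<in> A" "N \<in> A" for M N
  proof -
    obtain V V' where V: "normal_sequence \<sigma> V" "M = (\<Inter>n. V n)" "normal_sequence \<sigma> V'" "N = (\<Inter>n. V' n)"
      using \<open>M \<in> A\<close> \<open>N \<in> A\<close> unfolding A_def by blast
    then show ?thesis
      unfolding A_def using normal_sequence_Int[OF V(1,3)] by blast
  qed
  have dir: "directed_set A r"
    unfolding directed_set_def preorder_on_def
  proof (intro conjI ballI)
    have "zero_nbhd \<sigma> UNIV"
      using top unfolding zero_nbhd_def by (metis UNIV_I openin_topspace order_refl)
    then obtain V where "normal_sequence \<sigma> V"
      using normal_sequence_exists[OF ls] by metis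
    then show "A \<noteq> {}" unfolding A_def by blast
    fix M N assume "M \<in> A" "N \<in> A"
    then show "\<exists>c\<in>A. (M, c) \<in> r \<and> (N, c) \<in> r"
      using Int_A by (intro bexI[of _ "M \<inter> N"]) (auto simp: r_def)
  qed (auto simp: r_def refl_on_def trans_def)
  have "\<exists>u. u \<in> N \<and> u \<notin> W" if "N \<in> A" for N
    using * that unfolding A_def by blast
  then obtain u where u: "\<And>N. N \<in> A \<Longrightarrow> u N \<in> N" "\<And>N. N \<in> A \<Longrightarrow> u N \<notin> W"
    by metis
  have "uo_convergent UNIV u 0 (tails A r)"
  proof (rule uo_convergentI_dense[OF tails_neq_bot[OF dir]])
    fix z :: 'a assume z: "0 < z"
    then obtain U where "zero_nbhd \<sigma> U" "z \<notin> U"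
      using Hausdorff_zero_nbhd[OF \<sigma>(2), of z] top by auto
    then obtain V where V: "normal_sequence \<sigma> V" "z \<notin> V 0"
      using normal_sequence_exists[OF ls] by (metis subsetD)
    then obtain v where v: "0 < v" "v \<le> z" "v \<in> disjoint_complement (\<Inter>n. V n)"
      using normal_Inter_order_closed[OF leb V(1) z] by blast
    have "(\<Inter>n. V n) \<in> A" using V(1) by (auto simp: A_def)
    \<comment> \<open>From this index on the truncation vanishes identically: \<open>u N\<close>
      lies in the intersection, from which \<open>v\<close> is disjoint.\<close>
    moreover have "inf \<bar>u N\<bar> v = 0" if "((\<Inter>n. V n), N) \<in> r" for N
    proof -
      have "u N \<in> (\<Inter>n. V n)" using u(1)[of N] that by (auto simp: r_def)
      then have "inf \<bar>u N\<bar> \<bar>v\<bar> = 0" using v(3) unfolding disjoint_complement_def by blast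
      then show ?thesis using v(1) by simp
    qed
    ultimately have ev: "\<forall>\<^sub>F N in tails A r. inf \<bar>u N\<bar> v \<le> 0"
      unfolding eventually_tails[OF dir] by (metis order_refl)
    have nonneg: "0 \<le> inf \<bar>u N\<bar> v" for N using v(1) by simp
    have "order_convergent UNIV (\<lambda>N. inf \<bar>u N\<bar> v) 0 (tails A r)"
      unfolding order_convergent_0_iff[OF order_ideal_UNIV tails_neq_bot[OF dir] nonneg]
      using ev by blast
    then show "\<exists>v. 0 < v \<and> v \<le> z \<and> order_convergent UNIV (\<lambda>N. inf \<bar>u N\<bar> v) 0 (tails A r)"
      using v by blast
  qed
  then have "limitin \<tau> u 0 (tails A r)"
    by (intro uo_Lebesgue_any_net[OF \<tau> dir]) auto
  then obtain N where "N \<in> A" "\<And>M. M \<in> A \<Longrightarrow> (N, M) \<in> r \<Longrightarrow> u M \<in> W"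
    using W unfolding limitin_0_iff eventually_tails[OF dir] by blast
  then show False using u(2)[of N] by (auto simp: r_def)
qed

text \<open>This is the sum of the two ideals, described by domination so that solidity is immediate
  and no Riesz decomposition has to be carried out.\<close>

lemma order_ideal_dominated_sum:
  fixes M N :: "'a::archimedean_vector_lattice set"
  assumes M: "order_ideal M" and N: "order_ideal N"
  shows "order_ideal {w. \<exists>p\<in>M. \<exists>q\<in>N. \<bar>w\<bar> \<le> \<bar>p\<bar> + \<bar>q\<bar>}"
proof (rule order_idealI)
  show "0 \<in> {w. \<exists>p\<in>M. \<exists>q\<in>N. \<bar>w\<bar> \<le> \<bar>p\<bar> + \<bar>q\<bar>}"
    using order_ideal_0[OF M] order_ideal_0[OF N] by force
  show "x \<in> {w. \<exists>p\<in>M. \<exists>q\<in>N. \<bar>w\<bar> \<le> \<bar>p\<bar> + \<bar>q\<bar>}"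
    if "y \<in> {w. \<exists>p\<in>M. \<exists>q\<in>N. \<bar>w\<bar> \<le> \<bar>p\<bar> + \<bar>q\<bar>}" "\<bar>x\<bar> \<le> \<bar>y\<bar>" for x y
    using that order_trans by blast
  fix x y assume "x \<in> {w. \<exists>p\<in>M. \<exists>q\<in>N. \<bar>w\<bar> \<le> \<bar>p\<bar> + \<bar>q\<bar>}" "y \<in> {w. \<exists>p\<in>M. \<exists>q\<in>N. \<bar>w\<bar> \<le> \<bar>p\<bar> + \<bar>q\<bar>}"
  then obtain p q p' q' where pq: "p \<in> M" "q \<in> N" "\<bar>x\<bar> \<le> \<bar>p\<bar> + \<bar>q\<bar>"
    and pq': "p' \<in> M" "q' \<in> N" "\<bar>y\<bar> \<le> \<bar>p'\<bar> + \<bar>q'\<bar>"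
    by blast
  have "\<bar>x + y\<bar> \<le> (\<bar>p\<bar> + \<bar>q\<bar>) + (\<bar>p'\<bar> + \<bar>q'\<bar>)"
    using abs_triangle_ineq[of x y] add_mono[OF pq(3) pq'(3)] by order
  also have "\<dots> = \<bar>\<bar>p\<bar> + \<bar>p'\<bar>\<bar> + \<bar>\<bar>q\<bar> + \<bar>q'\<bar>\<bar>"
    by (simp add: add.assoc add.left_commute)
  finally show "x + y \<in> {w. \<exists>p\<in>M. \<exists>q\<in>N. \<bar>w\<bar> \<le> \<bar>p\<bar> + \<bar>q\<bar>}"
    using order_ideal_add[OF M order_ideal_abs[OF M pq(1)] order_ideal_abs[OF M pq'(1)]]
      order_ideal_add[OF N order_ideal_abs[OF N pq(2)] order_ideal_abs[OF N pq'(2)]] by blast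
qed

text \<open>The sum of \<open>N\<close> and its disjoint complement is order dense, so it
  approximates \<open>x\<close> from below in \<tau>; \<open>d\<close> is the error. The bound
  \<open>q \<le> x\<close> later transfers membership in a solid set from \<open>x\<close> to
  \<open>q\<close>.\<close>

lemma decompose_up_to_zero_nbhd:
  fixes x :: "'a::archimedean_vector_lattice"
  assumes \<tau>: "o_Lebesgue_topology UNIV \<tau>" and W: "zero_nbhd \<tau> W" and N: "order_ideal N" and x: "0 \<le> x"
  shows "\<exists>d\<in>W. \<exists>p\<in>N. \<exists>q\<in>disjoint_complement N.
    0 \<le> d \<and> 0 \<le> p \<and> 0 \<le> q \<and> q \<le> x \<and> x \<le> d + p + q"
proof -
  let ?C = "disjoint_complement N"
  have C: "order_ideal ?C" by (rule order_ideal_disjoint_complement)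
  let ?K = "{w. \<exists>p\<in>N. \<exists>q\<in>?C. \<bar>w\<bar> \<le> \<bar>p\<bar> + \<bar>q\<bar>}"
  have "directed_to_zero UNIV {x - w |w. w \<in> ?K \<and> 0 \<le> w \<and> w \<le> x}"
  proof (rule directed_to_zero_differences[OF order_ideal_UNIV UNIV_I order_ideal_dominated_sum[OF N C] x])
    fix z :: 'a assume z: "0 < z"
    have "N \<subseteq> ?K" "?C \<subseteq> ?K"
      using order_ideal_0[OF N] order_ideal_0[OF C] by force+
    then show "\<exists>u\<in>?K. 0 < u \<and> u \<le> z"
      using exists_below_in_or_disjoint[OF N z] z by blast
  qed
  from o_Lebesgue_directed_to_zero[OF \<tau> this W UNIV_I]
  obtain w p q where w: "x - w \<in> W" "0 \<le> w" "w \<le> x" and pq: "p \<in> N" "q \<in> ?C" "w \<le> \<bar>p\<bar> + \<bar>q\<bar>"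
    by (auto intro: order_trans)
  \<comment> \<open>Truncating \<open>p\<close> and \<open>q\<close> at \<open>w\<close> replaces a
    Riesz decomposition: the sum still dominates \<open>w\<close>, and each part now lies below
    \<open>x\<close>.\<close>
  have "w \<le> inf \<bar>p\<bar> w + inf \<bar>q\<bar> w"
    using inf_add_le[of "\<bar>p\<bar>" "\<bar>q\<bar>" w] pq(3) w(2) by (simp add: inf.absorb2)
  then have "x \<le> (x - w) + inf \<bar>p\<bar> w + inf \<bar>q\<bar> w"
    by (simp add: algebra_simps)
  moreover have "inf \<bar>p\<bar> w \<in> N" "inf \<bar>q\<bar> w \<in> ?C"
    using w(2) order_ideal_le[OF N pq(1)] order_ideal_le[OF C pq(2)] by auto
  ultimately show ?thesis
    using w by (intro bexI[of _ "x - w"] bexI[of _ "inf \<bar>p\<bar> w"] bexI[of _ "inf \<bar>q\<bar> w"]) (auto intro: le_infI2)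
qed

text \<open>Used in both directions, this yields uniqueness. The roles differ: \<sigma> supplies
  \<open>N\<close> and the sets \<open>V n\<close>, while \<tau> supplies the approximation error
  and the final limit.\<close>

lemma uo_Lebesgue_coarser:
  fixes \<sigma> \<tau> :: "'a::archimedean_vector_lattice topology"
  assumes \<sigma>: "uo_Lebesgue_topology UNIV \<sigma>" "Hausdorff_space \<sigma>" and \<tau>: "uo_Lebesgue_topology UNIV \<tau>"
    and U: "zero_nbhd \<tau> U"
  shows "zero_nbhd \<sigma> U"
proof (rule ccontr)
  assume nU: "\<not> zero_nbhd \<sigma> U"
  have ls: "locally_solid_topology UNIV \<tau>"
    using \<tau> by (simp add: uo_Lebesgue_topology_def)
  note leb_\<sigma> = o_Lebesgue_if_uo_Lebesgue[OF \<sigma>(1)] and leb_\<tau> = o_Lebesgue_if_uo_Lebesgue[OF \<tau>]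
  obtain U' where U': "solid UNIV U'" "zero_nbhd \<tau> U'" "U' \<subseteq> U"
    using zero_nbhd_solid[OF ls U] by blast
  \<comment> \<open>Three summands have to fit into \<open>U'\<close>, hence two halvings:
    \<open>d + p\<close> goes into \<open>W'\<close>, and then \<open>q\<close> is added.\<close>
  obtain W' where W': "solid UNIV W'" "zero_nbhd \<tau> W'" "\<forall>x\<in>W'. \<forall>y\<in>W'. x + y \<in> U'"
    using zero_nbhd_solid_halve[OF ls U'(2)] by blast
  obtain W where W: "zero_nbhd \<tau> W" "W \<subseteq> W'" "\<forall>x\<in>W. \<forall>y\<in>W. x + y \<in> W'"
    using zero_nbhd_solid_halve[OF ls W'(2)] by blast
  obtain V where V: "normal_sequence \<sigma> V" and "(\<Inter>n. V n) \<subseteq> W"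
    using uo_Lebesgue_zero_nbhd_contains_normal_Inter[OF \<sigma> \<tau> W(1)] by blast
  define N where "N = (\<Inter>n. V n)"
  have NW: "N \<subseteq> W" unfolding N_def by fact
  have N: "order_ideal N" unfolding N_def by (rule order_ideal_normal_Inter[OF V])
  have "\<exists>x. x \<in> V n \<and> x \<notin> U'" for n
    using nU U'(3) V zero_nbhd_mono unfolding normal_sequence_def by blast
  then obtain x where x: "\<And>n. x n \<in> V n" "\<And>n. x n \<notin> U'" by metis
  \<comment> \<open>The splitting uses the o-Lebesgue property of \<tau>, not of \<sigma>, because
    the error \<open>d\<close> must be small in \<tau>.\<close>
  have "\<exists>d p q. d \<in> W \<and> p \<in> N \<and> q \<in> disjoint_complement N \<and>
      0 \<le> d \<and> 0 \<le> p \<and> 0 \<le> q \<and> q \<le> \<bar>x n\<bar> \<and> \<bar>x n\<bar> \<le> d + p + q" for n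
    using decompose_up_to_zero_nbhd[OF leb_\<tau> W(1) N abs_ge_zero[of "x n"]] by blast
  then obtain d p q where dpq: "\<And>n. d n \<in> W" "\<And>n. p n \<in> N" "\<And>n. q n \<in> disjoint_complement N"
    and pos: "\<And>n. 0 \<le> d n" "\<And>n. 0 \<le> p n" "\<And>n. 0 \<le> q n"
    and le: "\<And>n. q n \<le> \<bar>x n\<bar>" "\<And>n. \<bar>x n\<bar> \<le> d n + p n + q n"
    by metis
  let ?G = "tails UNIV {(m, n::nat). m \<le> n}"
  have qV: "q n \<in> V n" for n
    using normal_sequence_le[OF V x(1)[of n], of "q n"] pos(3)[of n] le(1)[of n] by simp
  have "uo_convergent UNIV q 0 ?G"
  proof (rule uo_convergentI_dense[OF tails_neq_bot[OF directed_set_nat]])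
    fix z :: 'a assume z: "0 < z"
    \<comment> \<open>At a level in \<open>N\<close> the truncations of \<open>q\<close> vanish by
      disjointness; at a level disjoint from \<open>N\<close> they are order null because
      \<open>q n\<close> lies in \<open>V n\<close>.\<close>
    consider y where "y \<in> N" "0 < y" "y \<le> z" | "z \<in> disjoint_complement N"
      using exists_below_in_or_disjoint[OF N z] by blast
    then show "\<exists>u. 0 < u \<and> u \<le> z \<and> order_convergent UNIV (\<lambda>n. inf \<bar>q n\<bar> u) 0 ?G"
    proof cases
      case 1
      have "inf \<bar>q n\<bar> y = 0" for n
        using dpq(3)[of n] 1 unfolding disjoint_complement_def by (auto simp: inf.commute)
      then have "order_convergent UNIV (\<lambda>n. inf \<bar>q n\<bar> y) 0 ?G"
        using order_convergent_0_iff[OF order_ideal_UNIV tails_neq_bot[OF directed_set_nat], of "\<lambda>n. 0::'a"]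
        by (auto intro: exI[of _ 0])
      then show ?thesis using 1 by blast
    next
      case 2
      then show ?thesis
        using normal_sequence_order_convergent[OF leb_\<sigma> V qV less_imp_le[OF z]] z unfolding N_def by blast
    qed
  qed
  then have "limitin \<tau> q 0 ?G"
    by (intro uo_Lebesgue_any_net[OF \<tau> directed_set_nat]) auto
  then obtain n where n: "q n \<in> W'"
    using W'(2) eventually_happens'[OF tails_neq_bot[OF directed_set_nat]] unfolding limitin_0_iff by blast
  have "d n + p n \<in> W'" using W(3) NW dpq(1,2) by blast
  then have "d n + p n + q n \<in> U'" using W'(3) n by blast
  moreover have "\<bar>x n\<bar> \<le> \<bar>d n + p n + q n\<bar>"
    using le(2)[of n] pos by simp
  ultimately have "x n \<in> U'" using U'(1) unfolding solid_def by blast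
  then show False using x(2) by blast
qed

lemma uo_Lebesgue_unique:
  fixes \<sigma> \<tau> :: "'a::archimedean_vector_lattice topology"
  assumes "uo_Lebesgue_topology UNIV \<sigma>" "Hausdorff_space \<sigma>"
    and "uo_Lebesgue_topology UNIV \<tau>" "Hausdorff_space \<tau>"
  shows "\<sigma> = \<tau>"
  using assms uo_Lebesgue_coarser
  by (intro topology_eq_zero_nbhd)
    (auto simp: uo_Lebesgue_topology_def locally_solid_topology_def linear_topology_def)

section \<open>The unbounded topology\<close>

lemma limitin_0_dominated:
  assumes \<tau>: "locally_solid_topology F \<tau>" and g: "limitin \<tau> g 0 G"
    and f: "\<And>a. f a \<in> F" "\<And>a. \<bar>f a\<bar> \<le> \<bar>g a\<bar>"
  shows "limitin \<tau> f 0 G"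
  unfolding limitin_0_iff
proof (intro conjI allI impI)
  show "0 \<in> topspace \<tau>" using g by (simp add: limitin_def)
  fix U assume "zero_nbhd \<tau> U"
  then obtain S where S: "solid F S" "zero_nbhd \<tau> S" "S \<subseteq> U"
    using zero_nbhd_solid[OF \<tau>] by blast
  then have "\<forall>\<^sub>F a in G. g a \<in> S" using g unfolding limitin_0_iff by blast
  then show "\<forall>\<^sub>F a in G. f a \<in> U"
    by eventually_elim (use S f in \<open>unfold solid_def, blast\<close>)
qed

lemma limitin_0_add:
  assumes \<tau>: "locally_solid_topology F \<tau>" and f: "limitin \<tau> f 0 G" and g: "limitin \<tau> g 0 G"
  shows "limitin \<tau> (\<lambda>a. f a + g a) 0 G"
  unfolding limitin_0_iff
proof (intro conjI allI impI)
  show "0 \<in> topspace \<tau>" using g by (simp add: limitin_def)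
  fix U assume "zero_nbhd \<tau> U"
  then obtain S where S: "zero_nbhd \<tau> S" "\<forall>x\<in>S. \<forall>y\<in>S. x + y \<in> U"
    using zero_nbhd_solid_halve[OF \<tau>] by blast
  have "\<forall>\<^sub>F a in G. f a \<in> S" "\<forall>\<^sub>F a in G. g a \<in> S"
    using f g S(1) unfolding limitin_0_iff by blast+
  then show "\<forall>\<^sub>F a in G. f a + g a \<in> U"
    by eventually_elim (use S(2) in blast)
qed

text \<open>\<open>inf_add_le\<close> bounds the truncation at a sum by the sum of the truncations;
  local solidity does the rest.\<close>

lemma order_ideal_truncations_converge:
  assumes F: "order_ideal F" and \<tau>: "locally_solid_topology F \<tau>"
  shows "order_ideal {y \<in> F. limitin \<tau> (\<lambda>a. inf \<bar>x a\<bar> \<bar>y\<bar>) 0 G}" (is "order_ideal ?J")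
proof (rule order_idealI)
  have top: "topspace \<tau> = F"
    using \<tau> by (simp add: locally_solid_topology_def linear_topology_def)
  have inF: "inf \<bar>x a\<bar> \<bar>y\<bar> \<in> F" if "y \<in> F" for a y
    using order_ideal_le[OF F that, of "inf \<bar>x a\<bar> \<bar>y\<bar>"] by simp
  show "0 \<in> ?J"
    using order_ideal_0[OF F] top by (simp add: inf.absorb2)
  show "v \<in> ?J" if y: "y \<in> ?J" "\<bar>v\<bar> \<le> \<bar>y\<bar>" for v y
  proof -
    have v: "v \<in> F" using order_ideal_solid[OF F] y by blast
    have "limitin \<tau> (\<lambda>a. inf \<bar>x a\<bar> \<bar>v\<bar>) 0 G"
      by (rule limitin_0_dominated[OF \<tau>, of "\<lambda>a. inf \<bar>x a\<bar> \<bar>y\<bar>"])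
        (use y inF[OF v] in \<open>auto intro: le_infI2\<close>)
    then show ?thesis using v by blast
  qed
  show "y + v \<in> ?J" if yv: "y \<in> ?J" "v \<in> ?J" for y v
  proof -
    have F': "y + v \<in> F" using order_ideal_add[OF F] yv by blast
    have "limitin \<tau> (\<lambda>a. inf \<bar>x a\<bar> \<bar>y\<bar> + inf \<bar>x a\<bar> \<bar>v\<bar>) 0 G"
      using yv by (intro limitin_0_add[OF \<tau>]) auto
    moreover have "\<bar>inf \<bar>x a\<bar> \<bar>y + v\<bar>\<bar> \<le> \<bar>inf \<bar>x a\<bar> \<bar>y\<bar> + inf \<bar>x a\<bar> \<bar>v\<bar>\<bar>" for a
    proof -
      have "inf \<bar>x a\<bar> \<bar>y + v\<bar> \<le> inf (\<bar>y\<bar> + \<bar>v\<bar>) \<bar>x a\<bar>"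
        by (simp add: abs_triangle_ineq le_infI2)
      also have "\<dots> \<le> inf \<bar>y\<bar> \<bar>x a\<bar> + inf \<bar>v\<bar> \<bar>x a\<bar>"
        by (rule inf_add_le) auto
      finally show ?thesis by (simp add: inf.commute)
    qed
    ultimately have "limitin \<tau> (\<lambda>a. inf \<bar>x a\<bar> \<bar>y + v\<bar>) 0 G"
      by (intro limitin_0_dominated[OF \<tau> _ inF[OF F']])
    then show ?thesis using F' by blast
  qed
qed

text \<open>In the bound \<open>(|y| - w) + inf |x a| w\<close> for \<open>inf |x a| |y|\<close>,
  the first summand does not depend on the index, so it can be made small before the index is
  chosen; for \<open>w\<close> in \<open>J\<close> the second tends to zero.\<close>

lemma truncations_converge_iff:
  fixes F :: "'a::archimedean_vector_lattice set"
  assumes F: "order_ideal F" and \<tau>: "o_Lebesgue_topology F \<tau>"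
    and S: "S \<subseteq> F" "order_dense (order_ideal hull S)"
  shows "(\<forall>s\<in>S. limitin \<tau> (\<lambda>a. inf \<bar>x a\<bar> \<bar>s\<bar>) 0 G) \<longleftrightarrow> (\<forall>y\<in>F. limitin \<tau> (\<lambda>a. inf \<bar>x a\<bar> \<bar>y\<bar>) 0 G)"
proof
  assume *: "\<forall>s\<in>S. limitin \<tau> (\<lambda>a. inf \<bar>x a\<bar> \<bar>s\<bar>) 0 G"
  have ls: "locally_solid_topology F \<tau>" using \<tau> by (simp add: o_Lebesgue_topology_def)
  have top: "topspace \<tau> = F"
    using ls by (simp add: locally_solid_topology_def linear_topology_def)
  define J where "J = {y \<in> F. limitin \<tau> (\<lambda>a. inf \<bar>x a\<bar> \<bar>y\<bar>) 0 G}"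
  have J: "order_ideal J"
    unfolding J_def by (rule order_ideal_truncations_converge[OF F ls])
  have "order_ideal hull S \<subseteq> J"
    using * S(1) by (intro hull_minimal J) (auto simp: J_def)
  then have dense: "\<exists>u\<in>J. 0 < u \<and> u \<le> z" if "0 < z" for z
    using S(2) that unfolding order_dense_def by blast
  show "\<forall>y\<in>F. limitin \<tau> (\<lambda>a. inf \<bar>x a\<bar> \<bar>y\<bar>) 0 G"
  proof
    fix y assume y: "y \<in> F"
    have y': "\<bar>y\<bar> \<in> F" by (rule order_ideal_abs[OF F y])
    show "limitin \<tau> (\<lambda>a. inf \<bar>x a\<bar> \<bar>y\<bar>) 0 G"
      unfolding limitin_0_iff
    proof (intro conjI allI impI)
      show "0 \<in> topspace \<tau>" using top order_ideal_0[OF F] by simp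
      fix U assume "zero_nbhd \<tau> U"
      then obtain U' where U': "solid F U'" "zero_nbhd \<tau> U'" "U' \<subseteq> U"
        using zero_nbhd_solid[OF ls] by blast
      obtain W where W: "zero_nbhd \<tau> W" "\<forall>x\<in>W. \<forall>y\<in>W. x + y \<in> U'"
        using zero_nbhd_solid_halve[OF ls U'(2)] by blast
      have "directed_to_zero F {\<bar>y\<bar> - w |w. w \<in> J \<and> 0 \<le> w \<and> w \<le> \<bar>y\<bar>}"
        using dense by (intro directed_to_zero_differences[OF F y' J]) auto
      from o_Lebesgue_directed_to_zero[OF \<tau> this W(1) order_ideal_0[OF F]]
      obtain w where w: "w \<in> J" "0 \<le> w" "w \<le> \<bar>y\<bar>" "\<bar>y\<bar> - w \<in> W" by blast
      have "\<forall>\<^sub>F a in G. inf \<bar>x a\<bar> \<bar>w\<bar> \<in> W"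
        using w(1) W(1) unfolding J_def limitin_0_iff by blast
      then show "\<forall>\<^sub>F a in G. inf \<bar>x a\<bar> \<bar>y\<bar> \<in> U"
      proof eventually_elim
        case (elim a)
        have "(\<bar>y\<bar> - w) + inf \<bar>x a\<bar> w \<in> U'"
          using elim W(2) w(2,4) by simp
        moreover have "inf \<bar>x a\<bar> \<bar>y\<bar> \<in> F"
          using order_ideal_le[OF F y, of "inf \<bar>x a\<bar> \<bar>y\<bar>"] by simp
        moreover have "\<bar>inf \<bar>x a\<bar> \<bar>y\<bar>\<bar> \<le> \<bar>(\<bar>y\<bar> - w) + inf \<bar>x a\<bar> w\<bar>"
          using inf_le_diff_add[of "\<bar>x a\<bar>" w "\<bar>y\<bar>"] w by simp
        ultimately show ?case using U' unfolding solid_def by blast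
      qed
    qed
  qed
next
  assume "\<forall>y\<in>F. limitin \<tau> (\<lambda>a. inf \<bar>x a\<bar> \<bar>y\<bar>) 0 G"
  then show "\<forall>s\<in>S. limitin \<tau> (\<lambda>a. inf \<bar>x a\<bar> \<bar>s\<bar>) 0 G" using S(1) by blast
qed

section \<open>Construction of the unbounded topology\<close>

text \<open>Here \<open>x\<close> ranges over the whole lattice while \<tau> lives on
  \<open>F\<close>, so continuity of scalar multiplication in \<tau> does not apply to
  \<open>x\<close>; the o-Lebesgue property takes its place.\<close>

lemma o_Lebesgue_absorbing:
  fixes F :: "'a::archimedean_vector_lattice set"
  assumes F: "order_ideal F" "y \<in> F" and \<tau>: "o_Lebesgue_topology F \<tau>"
    and W: "solid F W" "zero_nbhd \<tau> W"
  shows "\<exists>e>0. \<forall>c. \<bar>c\<bar> < e \<longrightarrow> inf \<bar>c *\<^sub>R x\<bar> \<bar>y\<bar> \<in> W"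
proof -
  let ?d = "\<lambda>n. inf ((1 / real (Suc n)) *\<^sub>R \<bar>x\<bar>) \<bar>y\<bar>"
  have pos: "0 \<le> ?d n" for n by (simp add: scaleR_nonneg_nonneg)
  have mono: "?d n \<le> ?d m" if "m \<le> n" for m n
    using that by (intro inf_mono scaleR_right_mono) (auto simp: field_simps)
  have "directed_to_zero F (range ?d)"
    unfolding directed_to_zero_def
  proof (intro conjI ballI impI)
    show "range ?d \<subseteq> F" using order_ideal_le[OF F pos] by auto
    show "range ?d \<noteq> {}" by blast
    fix a b assume "a \<in> range ?d" "b \<in> range ?d"
    then obtain m n where "a = ?d m" "b = ?d n" by blast
    then show "\<exists>c\<in>range ?d. c \<le> a \<and> c \<le> b"
      using mono[of m "max m n"] mono[of n "max m n"] by (intro bexI[of _ "?d (max m n)"]) auto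
  next
    fix a assume "a \<in> range ?d"
    then show "0 \<le> a" using pos by blast
  next
    fix z assume z: "\<forall>d\<in>range ?d. z \<le> d"
    show "z \<le> 0"
    proof (rule archimedean)
      fix n
      show "of_nat n *\<^sub>R z \<le> \<bar>x\<bar>"
      proof (cases n)
        case (Suc m)
        have "z \<le> (1 / real (Suc m)) *\<^sub>R \<bar>x\<bar>" using z by (meson le_infE rangeI)
        then have "real (Suc m) *\<^sub>R z \<le> real (Suc m) *\<^sub>R ((1 / real (Suc m)) *\<^sub>R \<bar>x\<bar>)"
          by (intro scaleR_left_mono) auto
        then show ?thesis using Suc by simp
      qed simp
    qed
  qed
  from o_Lebesgue_directed_to_zero[OF \<tau> this W(2) order_ideal_0[OF F(1)]]
  obtain n where n: "?d n \<in> W" by blast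
  have "inf \<bar>c *\<^sub>R x\<bar> \<bar>y\<bar> \<in> W" if "\<bar>c\<bar> < 1 / real (Suc n)" for c
  proof -
    have "\<bar>c *\<^sub>R x\<bar> \<le> (1 / real (Suc n)) *\<^sub>R \<bar>x\<bar>"
      using abs_scaleR_le[of c x] that
      by (meson abs_ge_zero less_imp_le order_trans scaleR_right_mono)
    then have "inf \<bar>c *\<^sub>R x\<bar> \<bar>y\<bar> \<le> ?d n" by (rule inf_mono) simp
    then have "\<bar>inf \<bar>c *\<^sub>R x\<bar> \<bar>y\<bar>\<bar> \<le> \<bar>?d n\<bar>" using pos[of n] by simp
    moreover have "inf \<bar>c *\<^sub>R x\<bar> \<bar>y\<bar> \<in> F"
      using order_ideal_le[OF F, of "inf \<bar>c *\<^sub>R x\<bar> \<bar>y\<bar>"] by simp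
    ultimately show ?thesis using W(1) n unfolding solid_def by blast
  qed
  then show ?thesis by (intro exI[of _ "1 / real (Suc n)"]) auto
qed

text \<open>The second conclusion serves the Hausdorff property, the third is the net criterion. It
  concerns a single index type \<open>'i\<close>, picked by the caller, because a fact about an
  obtained \<sigma> cannot be polymorphic in that type.\<close>

lemma unbounded_topology_exists:
  fixes F :: "'a::archimedean_vector_lattice set"
  assumes F: "order_ideal F" and \<tau>: "o_Lebesgue_topology F \<tau>"
  obtains \<sigma> where "locally_solid_topology UNIV \<sigma>"
    "\<And>y W. y \<in> F \<Longrightarrow> zero_nbhd \<tau> W \<Longrightarrow> zero_nbhd \<sigma> {x. inf \<bar>x\<bar> \<bar>y\<bar> \<in> W}"
    "\<And>(x::'i \<Rightarrow> 'a) l G. limitin \<sigma> x l G \<longleftrightarrow> (\<forall>y\<in>F. limitin \<tau> (\<lambda>a. inf \<bar>x a - l\<bar> \<bar>y\<bar>) 0 G)"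
proof -
  have ls: "locally_solid_topology F \<tau>" using \<tau> by (simp add: o_Lebesgue_topology_def)
  have top: "topspace \<tau> = F"
    using ls by (simp add: locally_solid_topology_def linear_topology_def)
  define N where "N y W = {x. inf \<bar>x\<bar> \<bar>y\<bar> \<in> W}" for y :: 'a and W
  define \<B> where "\<B> = {N y W | y W. y \<in> F \<and> solid F W \<and> zero_nbhd \<tau> W}"
  have inF: "inf \<bar>x\<bar> \<bar>y\<bar> \<in> F" if "y \<in> F" for x y
    using order_ideal_le[OF F that, of "inf \<bar>x\<bar> \<bar>y\<bar>"] by simp
  have mono: "N y W \<subseteq> N y' W'" if W': "solid F W'" "W \<subseteq> W'" and y: "y' \<in> F" "\<bar>y'\<bar> \<le> \<bar>y\<bar>" for y W y' W'
  proof
    fix x assume "x \<in> N y W"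
    then have "inf \<bar>x\<bar> \<bar>y\<bar> \<in> W'" using W' by (auto simp: N_def)
    moreover have "\<bar>inf \<bar>x\<bar> \<bar>y'\<bar>\<bar> \<le> \<bar>inf \<bar>x\<bar> \<bar>y\<bar>\<bar>" using y(2) by (simp add: le_infI2)
    ultimately show "x \<in> N y' W'"
      using W'(1) inF[OF y(1)] unfolding N_def solid_def by blast
  qed
  have solid_N: "solid UNIV (N y W)" if W: "solid F W" and y: "y \<in> F" for y W
    unfolding solid_def
  proof safe
    fix x v assume "v \<in> N y W" "\<bar>x\<bar> \<le> \<bar>v\<bar>"
    moreover then have "\<bar>inf \<bar>x\<bar> \<bar>y\<bar>\<bar> \<le> \<bar>inf \<bar>v\<bar> \<bar>y\<bar>\<bar>" by (simp add: le_infI1)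
    ultimately show "x \<in> N y W"
      using W inF[OF y] unfolding N_def solid_def by blast
  qed simp
  have halve_N: "x + v \<in> N y W"
    if W: "solid F W" and y: "y \<in> F" and W': "\<forall>x\<in>W'. \<forall>y\<in>W'. x + y \<in> W" and xv: "x \<in> N y W'" "v \<in> N y W'"
    for x v y W W'
  proof -
    have "inf \<bar>x + v\<bar> \<bar>y\<bar> \<le> inf (\<bar>x\<bar> + \<bar>v\<bar>) \<bar>y\<bar>"
      by (simp add: abs_triangle_ineq le_infI1)
    also have "\<dots> \<le> inf \<bar>x\<bar> \<bar>y\<bar> + inf \<bar>v\<bar> \<bar>y\<bar>"
      by (rule inf_add_le) auto
    finally have "\<bar>inf \<bar>x + v\<bar> \<bar>y\<bar>\<bar> \<le> \<bar>inf \<bar>x\<bar> \<bar>y\<bar> + inf \<bar>v\<bar> \<bar>y\<bar>\<bar>" by simp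
    moreover have "inf \<bar>x\<bar> \<bar>y\<bar> + inf \<bar>v\<bar> \<bar>y\<bar> \<in> W"
      using W' xv by (simp add: N_def)
    ultimately show ?thesis
      using W inF[OF y] unfolding N_def solid_def by blast
  qed
  have zero_N: "0 \<in> N y W" if "zero_nbhd \<tau> W" for y W
    using zero_nbhd_zero[OF that] by (simp add: N_def inf.absorb1)
  obtain \<sigma> where \<sigma>: "locally_solid_topology UNIV \<sigma>" "\<And>U. zero_nbhd \<sigma> U \<longleftrightarrow> (\<exists>B\<in>\<B>. B \<subseteq> U)"
    "\<And>(x::'i \<Rightarrow> 'a) l G. limitin \<sigma> x l G \<longleftrightarrow> (\<forall>B\<in>\<B>. \<forall>\<^sub>F a in G. x a - l \<in> B)"
  proof (rule locally_solid_topology_of_base[of \<B>])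
    have "zero_nbhd \<tau> F"
      unfolding zero_nbhd_def using top order_ideal_0[OF F] openin_topspace by blast
    moreover have "solid F F" by (auto simp: solid_def)
    ultimately show "\<B> \<noteq> {}" using order_ideal_0[OF F] unfolding \<B>_def by blast
  next
    show "0 \<in> B" if "B \<in> \<B>" for B using that zero_N unfolding \<B>_def by blast
  next
    fix A B assume "A \<in> \<B>" "B \<in> \<B>"
    then obtain y W y' W' where A: "A = N y W" "y \<in> F" "solid F W" "zero_nbhd \<tau> W"
      and B: "B = N y' W'" "y' \<in> F" "solid F W'" "zero_nbhd \<tau> W'"
      unfolding \<B>_def by blast
    \<comment> \<open>Truncation at the sum dominates both truncations, so a single set of the base
      refines both.\<close>
    let ?y = "\<bar>y\<bar> + \<bar>y'\<bar>"
    have y: "?y \<in> F" using A B by (simp add: order_ideal_add[OF F] order_ideal_abs[OF F])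
    have W: "solid F (W \<inter> W')" using A(3) B(3) unfolding solid_def by blast
    have "N ?y (W \<inter> W') \<in> \<B>"
      unfolding \<B>_def using y W zero_nbhd_Int[OF A(4) B(4)] by blast
    moreover have "N ?y (W \<inter> W') \<subseteq> A"
      unfolding A(1) by (rule mono[OF A(3) _ A(2)]) auto
    moreover have "N ?y (W \<inter> W') \<subseteq> B"
      unfolding B(1) by (rule mono[OF B(3) _ B(2)]) auto
    ultimately show "\<exists>C\<in>\<B>. C \<subseteq> A \<inter> B" by blast
  next
    fix A assume "A \<in> \<B>"
    then obtain y W where A: "A = N y W" "y \<in> F" "solid F W" "zero_nbhd \<tau> W"
      unfolding \<B>_def by blast
    obtain W' where W': "solid F W'" "zero_nbhd \<tau> W'" "\<forall>x\<in>W'. \<forall>y\<in>W'. x + y \<in> W"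
      using zero_nbhd_solid_halve[OF ls A(4)] by blast
    have "N y W' \<in> \<B>" unfolding \<B>_def using A W' by blast
    then show "\<exists>B\<in>\<B>. \<forall>x\<in>B. \<forall>y\<in>B. x + y \<in> A"
      using halve_N[OF A(3,2) W'(3)] A(1) by blast
  next
    show "solid UNIV B" if "B \<in> \<B>" for B using that solid_N unfolding \<B>_def by blast
  next
    fix B x assume "B \<in> \<B>"
    then show "\<exists>e>0. \<forall>c. \<bar>c\<bar> < e \<longrightarrow> c *\<^sub>R x \<in> B"
      using o_Lebesgue_absorbing[OF F _ \<tau>] unfolding \<B>_def N_def by blast
  qed (rule that)
  have base: "\<exists>B\<in>\<B>. B \<subseteq> N y W" if y: "y \<in> F" and W: "zero_nbhd \<tau> W" for y W
  proof -
    obtain W' where W': "solid F W'" "zero_nbhd \<tau> W'" "W' \<subseteq> W"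
      using zero_nbhd_solid[OF ls W] by blast
    then have "N y W' \<in> \<B>" "N y W' \<subseteq> N y W" using y by (auto simp: \<B>_def N_def)
    then show ?thesis by blast
  qed
  show ?thesis
  proof (rule that[OF \<sigma>(1)])
    show "zero_nbhd \<sigma> {x. inf \<bar>x\<bar> \<bar>y\<bar> \<in> W}" if "y \<in> F" "zero_nbhd \<tau> W" for y W
      unfolding \<sigma>(2) using base[OF that] unfolding N_def .
    fix x :: "'i \<Rightarrow> 'a" and l G
    have 0: "0 \<in> topspace \<tau>" using top order_ideal_0[OF F] by simp
    have "(\<forall>B\<in>\<B>. \<forall>\<^sub>F a in G. x a - l \<in> B) \<longleftrightarrow> (\<forall>y\<in>F. \<forall>W. zero_nbhd \<tau> W \<longrightarrow> (\<forall>\<^sub>F a in G. x a - l \<in> N y W))"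
    proof
      assume *: "\<forall>B\<in>\<B>. \<forall>\<^sub>F a in G. x a - l \<in> B"
      show "\<forall>y\<in>F. \<forall>W. zero_nbhd \<tau> W \<longrightarrow> (\<forall>\<^sub>F a in G. x a - l \<in> N y W)"
      proof (intro ballI allI impI)
        fix y W assume "y \<in> F" "zero_nbhd \<tau> W"
        then obtain B where B: "B \<in> \<B>" "B \<subseteq> N y W" using base by blast
        have "\<forall>\<^sub>F a in G. x a - l \<in> B" using * B(1) by blast
        then show "\<forall>\<^sub>F a in G. x a - l \<in> N y W" by eventually_elim (use B(2) in blast)
      qed
    next
      assume "\<forall>y\<in>F. \<forall>W. zero_nbhd \<tau> W \<longrightarrow> (\<forall>\<^sub>F a in G. x a - l \<in> N y W)"
      then show "\<forall>B\<in>\<B>. \<forall>\<^sub>F a in G. x a - l \<in> B" unfolding \<B>_def by blast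
    qed
    then show "limitin \<sigma> x l G \<longleftrightarrow> (\<forall>y\<in>F. limitin \<tau> (\<lambda>a. inf \<bar>x a - l\<bar> \<bar>y\<bar>) 0 G)"
      unfolding \<sigma>(3) limitin_0_iff using 0 by (simp add: N_def)
  qed
qed

section \<open>Separation, uniqueness from nets, and the theorem\<close>

lemma Hausdorff_if_zero_nbhds_separate:
  fixes \<tau> :: "'a::archimedean_vector_lattice topology"
  assumes \<tau>: "locally_solid_topology UNIV \<tau>"
    and sep: "\<And>x. x \<noteq> 0 \<Longrightarrow> \<exists>U. zero_nbhd \<tau> U \<and> x \<notin> U"
  shows "Hausdorff_space \<tau>"
  unfolding Hausdorff_space_def
proof (intro allI impI)
  fix x y assume "x \<in> topspace \<tau> \<and> y \<in> topspace \<tau> \<and> x \<noteq> y"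
  then obtain U where U: "zero_nbhd \<tau> U" "x - y \<notin> U"
    using sep[of "x - y"] by auto
  obtain S where S: "solid UNIV S" "zero_nbhd \<tau> S" "\<forall>x\<in>S. \<forall>y\<in>S. x + y \<in> U"
    using zero_nbhd_solid_halve[OF \<tau> U(1)] by blast
  obtain T where T: "openin \<tau> T" "0 \<in> T" "T \<subseteq> S"
    using S(2) unfolding zero_nbhd_def by blast
  have "topspace \<tau> = UNIV" "continuous_map (prod_topology \<tau> \<tau>) \<tau> (\<lambda>(x, y). x + y)"
    using \<tau> by (auto simp: locally_solid_topology_def linear_topology_def)
  note op = openin_iff_zero_nbhd[OF this]
  have trans: "openin \<tau> {t. t - z \<in> T}" for z
    unfolding op using T(1)[unfolded op] by (auto simp: algebra_simps)
  have "disjnt {t. t - x \<in> T} {t. t - y \<in> T}"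
    unfolding disjnt_iff
  proof safe
    fix t assume t: "t - x \<in> T" "t - y \<in> T"
    \<comment> \<open>Solidity makes \<open>S\<close> symmetric.\<close>
    have "\<bar>x - t\<bar> \<le> \<bar>t - x\<bar>" by (simp add: abs_minus_commute)
    then have "x - t \<in> S" using S(1) t(1) T(3) unfolding solid_def by blast
    then have "(x - t) + (t - y) \<in> U" using S(3) T(3) t(2) by blast
    then show False using U(2) by simp
  qed
  then show "\<exists>A B. openin \<tau> A \<and> openin \<tau> B \<and> x \<in> A \<and> y \<in> B \<and> disjnt A B"
    using trans T(2) by (intro exI[of _ "{t. t - x \<in> T}"] exI[of _ "{t. t - y \<in> T}"]) auto
qed

lemma continuous_map_uminus_linear_topology:
  assumes "linear_topology UNIV \<tau>"
  shows "continuous_map \<tau> \<tau> uminus"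
proof -
  have "continuous_map \<tau> (prod_topology euclideanreal \<tau>) (\<lambda>x. (-1, x))"
    by (simp add: continuous_map_pairedI)
  then have "continuous_map \<tau> \<tau> ((\<lambda>(c, x). c *\<^sub>R x) \<circ> (\<lambda>x. (-1, x)))"
    using assms continuous_map_compose unfolding linear_topology_def by blast
  then show ?thesis by (simp add: o_def)
qed

lemma is_unbounded_topology_unique:
  assumes "is_unbounded_topology \<tau>F S \<sigma>" "is_unbounded_topology \<tau>F S \<tau>"
  shows "\<sigma> = \<tau>"
proof (rule topology_eq_zero_nbhd)
  have 0: "0 \<in> topspace \<sigma>" "0 \<in> topspace \<tau>"
    using assms by (auto simp: is_unbounded_topology_def additive_group_topology_def)
  show "zero_nbhd \<sigma> U \<longleftrightarrow> zero_nbhd \<tau> U" for U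
    using zero_nbhd_if_nets[OF 0(1), of \<tau> U] zero_nbhd_if_nets[OF 0(2), of \<sigma> U] assms
    unfolding is_unbounded_topology_def by blast
qed (use assms in \<open>auto simp: is_unbounded_topology_def additive_group_topology_def\<close>)

theorem theorem4p2:
  fixes F :: "'a::archimedean_vector_lattice set" and \<tau>F :: "'a topology"
  assumes "order_ideal F" and "order_dense F"
    and "o_Lebesgue_topology F \<tau>F" and "Hausdorff_space \<tau>F"
  shows "\<exists>\<tau>E :: 'a topology.
    uo_Lebesgue_topology UNIV \<tau>E \<and> Hausdorff_space \<tau>E \<and>
    (\<forall>\<tau>. uo_Lebesgue_topology UNIV \<tau> \<and> Hausdorff_space \<tau> \<longrightarrow> \<tau> = \<tau>E) \<and>
    (\<forall>S\<subseteq>F. order_dense (order_ideal hull S) \<longrightarrow>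
      (\<forall>\<tau>. is_unbounded_topology \<tau>F S \<tau> \<longleftrightarrow> \<tau> = \<tau>E) \<and>
      (\<forall>(A::'i set) r (x::'i \<Rightarrow> 'a). directed_set A r \<longrightarrow>
        (limitin \<tau>E x 0 (tails A r) \<longleftrightarrow>
          (\<forall>s\<in>S. limitin \<tau>F (\<lambda>a. inf \<bar>x a\<bar> \<bar>s\<bar>) 0 (tails A r))) \<and>
        ((\<forall>s\<in>S. limitin \<tau>F (\<lambda>a. inf \<bar>x a\<bar> \<bar>s\<bar>) 0 (tails A r)) \<longleftrightarrow>
          (\<forall>y\<in>F. limitin \<tau>F (\<lambda>a. inf \<bar>x a\<bar> \<bar>y\<bar>) 0 (tails A r)))))"
proof -
  have ls_F: "locally_solid_topology F \<tau>F" using assms(3) by (simp add: o_Lebesgue_topology_def)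
  have top_F: "topspace \<tau>F = F"
    using ls_F by (simp add: locally_solid_topology_def linear_topology_def)
  have 0: "0 \<in> F" by (rule order_ideal_0[OF assms(1)])
  \<comment> \<open>The net criterion is taken at the index type \<open>'a set \<times> 'a\<close>
    that the definitions quantify over; other index types are reached at the end through
    \<open>is_unbounded_topology_any_net\<close>.\<close>
  obtain \<tau>E where \<tau>E: "locally_solid_topology UNIV \<tau>E"
    "\<And>y W. y \<in> F \<Longrightarrow> zero_nbhd \<tau>F W \<Longrightarrow> zero_nbhd \<tau>E {x. inf \<bar>x\<bar> \<bar>y\<bar> \<in> W}"
    and lim: "\<And>(G::('a set \<times> 'a) filter) x l.
      limitin \<tau>E x l G \<longleftrightarrow> (\<forall>y\<in>F. limitin \<tau>F (\<lambda>a. inf \<bar>x a - l\<bar> \<bar>y\<bar>) 0 G)"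
    using unbounded_topology_exists[OF assms(1,3)] by metis
  have linear: "linear_topology UNIV \<tau>E"
    using \<tau>E(1) by (simp add: locally_solid_topology_def)
  have uo: "uo_Lebesgue_topology UNIV \<tau>E"
    unfolding uo_Lebesgue_topology_def
  proof (intro conjI allI ballI impI \<tau>E(1))
    fix A :: "('a set \<times> 'a) set" and r x and l :: 'a
    assume *: "directed_set A r \<and> x ` A \<subseteq> UNIV \<and> uo_convergent UNIV x l (tails A r)"
    show "limitin \<tau>E x l (tails A r)"
      unfolding lim
    proof
      fix y assume y: "y \<in> F"
      \<comment> \<open>\<tau>F only knows order convergence inside \<open>F\<close>, whereas
        uo-convergence is measured in the whole lattice; truncation at an element of the ideal
        bridges the two.\<close>
      have "order_convergent F (\<lambda>a. inf \<bar>x a - l\<bar> \<bar>y\<bar>) 0 (tails A r)"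
        using * by (intro order_convergent_subideal[OF assms(1) y] tails_neq_bot) (auto simp: uo_convergent_def)
      moreover have "inf \<bar>x a - l\<bar> \<bar>y\<bar> \<in> F" for a
        using order_ideal_le[OF assms(1) y, of "inf \<bar>x a - l\<bar> \<bar>y\<bar>"] by simp
      ultimately show "limitin \<tau>F (\<lambda>a. inf \<bar>x a - l\<bar> \<bar>y\<bar>) 0 (tails A r)"
        using * 0 by (intro o_Lebesgue_any_net[OF assms(3)]) auto
    qed
  qed
  have haus: "Hausdorff_space \<tau>E"
  proof (rule Hausdorff_if_zero_nbhds_separate[OF \<tau>E(1)])
    fix x :: 'a assume "x \<noteq> 0"
    then have "0 < \<bar>x\<bar>" by simp
    then obtain y where y: "y \<in> F" "0 < y" "y \<le> \<bar>x\<bar>"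
      using assms(2) unfolding order_dense_def by blast
    then obtain W where W: "zero_nbhd \<tau>F W" "y \<notin> W"
      using Hausdorff_zero_nbhd[OF assms(4), of y] top_F 0 by auto
    \<comment> \<open>With \<open>y\<close> below |x| the truncation returns \<open>y\<close>
      itself, which \<open>W\<close> excludes.\<close>
    have "inf \<bar>x\<bar> \<bar>y\<bar> = y" using y by (simp add: inf.absorb2)
    then show "\<exists>U. zero_nbhd \<tau>E U \<and> x \<notin> U"
      using \<tau>E(2)[OF y(1) W(1)] W(2) by (intro exI[of _ "{x. inf \<bar>x\<bar> \<bar>y\<bar> \<in> W}"]) simp
  qed
  \<comment> \<open>The criterion for \<open>S\<close> coincides with the one for all of
    \<open>F\<close>, so a single topology serves every admissible \<open>S\<close>.\<close>
  have unbounded: "is_unbounded_topology \<tau>F S \<tau>E"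
    if "S \<subseteq> F" "order_dense (order_ideal hull S)" for S
    unfolding is_unbounded_topology_def additive_group_topology_def
      lim diff_zero truncations_converge_iff[OF assms(1,3) that]
    using linear continuous_map_uminus_linear_topology[OF linear]
    by (simp add: linear_topology_def)
  show ?thesis
  proof (intro exI[of _ \<tau>E] conjI uo haus allI impI)
    fix \<tau> :: "'a topology" assume "uo_Lebesgue_topology UNIV \<tau> \<and> Hausdorff_space \<tau>"
    then show "\<tau> = \<tau>E" using uo_Lebesgue_unique[OF _ _ uo haus] by blast
  next
    fix S and \<tau> :: "'a topology" assume S: "S \<subseteq> F" "order_dense (order_ideal hull S)"
    show "is_unbounded_topology \<tau>F S \<tau> \<longleftrightarrow> \<tau> = \<tau>E"
      using is_unbounded_topology_unique[OF _ unbounded[OF S]] unbounded[OF S] by metis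
  next
    fix S and A :: "'i set" and r and x :: "'i \<Rightarrow> 'a"
    assume S: "S \<subseteq> F" "order_dense (order_ideal hull S)" and dir: "directed_set A r"
    show "limitin \<tau>E x 0 (tails A r) \<longleftrightarrow>
        (\<forall>s\<in>S. limitin \<tau>F (\<lambda>a. inf \<bar>x a\<bar> \<bar>s\<bar>) 0 (tails A r))"
      by (rule is_unbounded_topology_any_net[OF unbounded[OF S] dir])
    show "(\<forall>s\<in>S. limitin \<tau>F (\<lambda>a. inf \<bar>x a\<bar> \<bar>s\<bar>) 0 (tails A r)) \<longleftrightarrow>
        (\<forall>y\<in>F. limitin \<tau>F (\<lambda>a. inf \<bar>x a\<bar> \<bar>y\<bar>) 0 (tails A r))"
      by (rule truncations_converge_iff[OF assms(1,3) S])
  qed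
qed

end
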